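(* Let $n=2+2k$ with $k\ge1$ an integer, let $\ell>0$, $r_0>0$, $a\in\mathbb{R}$, $V(r)=\frac{r^2}{\ell^2}\left(1+\frac{a}{r^{n-1}}-\frac{r_0^n}{r^n}\right)$, and let $r_+>0$ be the largest positive root of $V$. Let $M=\mathbb{R}^2\times T^{n-2}$ be the manifold carrying the complete metric $$g=\frac1V dr^2+Vd\phi^2+r^2\sum_{i=1}^{n-2}(d\theta^i)^2,\qquad r\ge r_+,$$ where the $\theta^i$ are periodic with arbitrary periods and $\phi$ has period $\beta=\frac{4\pi\ell^2}{r_+\left(n-1+r_0^n/r_+^n\right)}$. Let $J$ be the almost-complex structure on $M$ which on $\{r>r_+\}$ is determined (acting on $1$-forms, $J^2=-\mathrm{Id}$) by $$\frac1V dr\longmapsto d\phi,\qquad d\theta^j\longmapsto d\theta^{k+j},\quad 1\le j\le k,$$ and is extended smoothly to $r=r_+$. Then $J$ is integrable and $g$-compatible.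
   Context: $V>0$ on $(r_+,\infty)$, $V(r_+)=0$ and $V'(r_+)=4\pi/\beta>0$. The smooth structure of $M$ near the locus $r=r_+$ (where the $\phi$-circles collapse) is given by coordinates $(x,y,\theta^1,\dots,\theta^{n-2})$ with $x=\rho\cos\Phi$, $y=\rho\sin\Phi$, $\rho=V(r)^{1/2}$, $\Phi=2\pi\phi/\beta$; the locus $r=r_+$ corresponds to $(x,y)=(0,0)$; both $g$ and $J$ extend smoothly across it. $g$-compatible means $g(J\cdot,J\cdot)=g(\cdot,\cdot)$. *)

theory Defs
  imports "HOL-Analysis.Analysis"
begin

section \<open>Smooth maps\<close>

text \<open>
  Iterated directional derivatives; for \<open>S\<close> open in a finite-dimensional space, \<open>smooth_on S f\<close>
  says that \<open>f\<close> is of class $C^\infty$ on \<open>S\<close>.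
\<close>

primrec Ck_on :: "'a::real_normed_vector set \<Rightarrow> ('a \<Rightarrow> 'b::real_normed_vector) \<Rightarrow> nat \<Rightarrow> bool" where
  "Ck_on S f 0 \<longleftrightarrow> continuous_on S f"
| "Ck_on S f (Suc m) \<longleftrightarrow> (\<forall>x\<in>S. f differentiable (at x)) \<and>
     (\<forall>v. Ck_on S (\<lambda>x. frechet_derivative f (at x) v) m)"

definition smooth_on :: "'a::real_normed_vector set \<Rightarrow> ('a \<Rightarrow> 'b::real_normed_vector) \<Rightarrow> bool" where
  "smooth_on S f \<longleftrightarrow> (\<forall>m. Ck_on S f m)"

section \<open>Charts\<close>

text \<open>
  A chart is a pair (domain, coordinate map); the values of the coordinate map outside the domain
  are irrelevant.
\<close>

type_synonym ('p, 'e) chart = "'p set \<times> ('p \<Rightarrow> 'e)"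

abbreviation cdom :: "('p, 'e) chart \<Rightarrow> 'p set" where "cdom \<equiv> fst"

abbreviation cmap :: "('p, 'e) chart \<Rightarrow> 'p \<Rightarrow> 'e" where "cmap \<equiv> snd"

definition cinv :: "('p, 'e) chart \<Rightarrow> 'e \<Rightarrow> 'p" where
  "cinv \<kappa> = inv_into (cdom \<kappa>) (cmap \<kappa>)"

definition is_chart :: "'p::topological_space set \<Rightarrow> ('p, 'e::real_normed_vector) chart \<Rightarrow> bool" where
  "is_chart M \<kappa> \<longleftrightarrow> openin (top_of_set M) (cdom \<kappa>) \<and> open (cmap \<kappa> ` cdom \<kappa>) \<and>
     homeomorphism (cdom \<kappa>) (cmap \<kappa> ` cdom \<kappa>) (cmap \<kappa>) (cinv \<kappa>)"

definition transition :: "('p, 'e) chart \<Rightarrow> ('p, 'f) chart \<Rightarrow> 'e \<Rightarrow> 'f" where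
  "transition \<kappa> \<kappa>' = cmap \<kappa>' \<circ> cinv \<kappa>"

definition smoothly_compatible ::
  "('p, 'e::real_normed_vector) chart \<Rightarrow> ('p, 'f::real_normed_vector) chart \<Rightarrow> bool" where
  "smoothly_compatible \<kappa> \<kappa>' \<longleftrightarrow>
     smooth_on (cmap \<kappa> ` (cdom \<kappa> \<inter> cdom \<kappa>')) (transition \<kappa> \<kappa>') \<and>
     smooth_on (cmap \<kappa>' ` (cdom \<kappa> \<inter> cdom \<kappa>')) (transition \<kappa>' \<kappa>)"

text \<open>Differential at the point \<open>p\<close> of the change of coordinates from \<open>\<kappa>\<close> to \<open>\<kappa>'\<close>.\<close>

definition dtransition ::
  "('p, 'e::real_normed_vector) chart \<Rightarrow> ('p, 'f::real_normed_vector) chart \<Rightarrow> 'p \<Rightarrow> 'e \<Rightarrow> 'f" where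
  "dtransition \<kappa> \<kappa>' p = frechet_derivative (transition \<kappa> \<kappa>') (at (cmap \<kappa> p))"

section \<open>Tensor fields\<close>

text \<open>
  Tensor fields are given by their coordinate expressions: for every chart \<open>\<kappa>\<close> of the atlas \<open>A\<close>, the
  tangent space at \<open>p\<close> is identified with the model space by means of \<open>\<kappa>\<close>, and the expressions
  in different charts are related by the usual transformation law.
\<close>

type_synonym ('p, 'e) endo_field = "('p, 'e) chart \<Rightarrow> 'p \<Rightarrow> 'e \<Rightarrow> 'e"

type_synonym ('p, 'e) bilinear_field = "('p, 'e) chart \<Rightarrow> 'p \<Rightarrow> 'e \<Rightarrow> 'e \<Rightarrow> real"

definition smooth_endo_field ::
  "('p, 'e::real_normed_vector) chart set \<Rightarrow> ('p, 'e) endo_field \<Rightarrow> bool" where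
  "smooth_endo_field A J \<longleftrightarrow>
     (\<forall>\<kappa>\<in>A. \<forall>p\<in>cdom \<kappa>. linear (J \<kappa> p)) \<and>
     (\<forall>\<kappa>\<in>A. \<forall>v. smooth_on (cmap \<kappa> ` cdom \<kappa>) (\<lambda>x. J \<kappa> (cinv \<kappa> x) v)) \<and>
     (\<forall>\<kappa>\<in>A. \<forall>\<kappa>'\<in>A. \<forall>p\<in>cdom \<kappa> \<inter> cdom \<kappa>'. \<forall>v.
        J \<kappa>' p (dtransition \<kappa> \<kappa>' p v) = dtransition \<kappa> \<kappa>' p (J \<kappa> p v))"

definition almost_complex_structure ::
  "('p, 'e::real_normed_vector) chart set \<Rightarrow> ('p, 'e) endo_field \<Rightarrow> bool" where
  "almost_complex_structure A J \<longleftrightarrow>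
     smooth_endo_field A J \<and> (\<forall>\<kappa>\<in>A. \<forall>p\<in>cdom \<kappa>. \<forall>v. J \<kappa> p (J \<kappa> p v) = - v)"

definition smooth_bilinear_field ::
  "('p, 'e::real_normed_vector) chart set \<Rightarrow> ('p, 'e) bilinear_field \<Rightarrow> bool" where
  "smooth_bilinear_field A g \<longleftrightarrow>
     (\<forall>\<kappa>\<in>A. \<forall>p\<in>cdom \<kappa>. bilinear (g \<kappa> p)) \<and>
     (\<forall>\<kappa>\<in>A. \<forall>v w. smooth_on (cmap \<kappa> ` cdom \<kappa>) (\<lambda>x. g \<kappa> (cinv \<kappa> x) v w)) \<and>
     (\<forall>\<kappa>\<in>A. \<forall>\<kappa>'\<in>A. \<forall>p\<in>cdom \<kappa> \<inter> cdom \<kappa>'. \<forall>v w.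
        g \<kappa>' p (dtransition \<kappa> \<kappa>' p v) (dtransition \<kappa> \<kappa>' p w) = g \<kappa> p v w)"

definition riemannian_metric ::
  "('p, 'e::real_normed_vector) chart set \<Rightarrow> ('p, 'e) bilinear_field \<Rightarrow> bool" where
  "riemannian_metric A g \<longleftrightarrow>
     smooth_bilinear_field A g \<and>
     (\<forall>\<kappa>\<in>A. \<forall>p\<in>cdom \<kappa>. (\<forall>v w. g \<kappa> p v w = g \<kappa> p w v) \<and> (\<forall>v. v \<noteq> 0 \<longrightarrow> 0 < g \<kappa> p v v))"

definition metric_compatible ::
  "('p, 'e) chart set \<Rightarrow> ('p, 'e) bilinear_field \<Rightarrow> ('p, 'e) endo_field \<Rightarrow> bool" where
  "metric_compatible A g J \<longleftrightarrow>
     (\<forall>\<kappa>\<in>A. \<forall>p\<in>cdom \<kappa>. \<forall>v w. g \<kappa> p (J \<kappa> p v) (J \<kappa> p w) = g \<kappa> p v w)"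

section \<open>Completeness\<close>

definition piecewise_C1_curve ::
  "'p::topological_space set \<Rightarrow> ('p, 'e::real_normed_vector) chart set \<Rightarrow> (real \<Rightarrow> 'p) \<Rightarrow> bool" where
  "piecewise_C1_curve M A \<gamma> \<longleftrightarrow> path \<gamma> \<and> path_image \<gamma> \<subseteq> M \<and>
     (\<exists>S. finite S \<and>
        (\<forall>\<kappa>\<in>A. (cmap \<kappa> \<circ> \<gamma>) C1_differentiable_on {t \<in> {0<..<1} - S. \<gamma> t \<in> cdom \<kappa>}))"

definition has_curve_length ::
  "('p, 'e::real_normed_vector) chart set \<Rightarrow> ('p, 'e) bilinear_field \<Rightarrow> (real \<Rightarrow> 'p) \<Rightarrow> real \<Rightarrow> bool" where
  "has_curve_length A g \<gamma> len \<longleftrightarrow>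
     (\<exists>S speed. finite S \<and>
        (\<forall>t\<in>{0<..<1} - S. \<forall>\<kappa>\<in>A. \<gamma> t \<in> cdom \<kappa> \<longrightarrow>
           (let v = vector_derivative (cmap \<kappa> \<circ> \<gamma>) (at t) in speed t = sqrt (g \<kappa> (\<gamma> t) v v))) \<and>
        (speed has_integral len) {0..1})"

definition riemannian_dist ::
  "'p::topological_space set \<Rightarrow> ('p, 'e::real_normed_vector) chart set \<Rightarrow>
     ('p, 'e) bilinear_field \<Rightarrow> 'p \<Rightarrow> 'p \<Rightarrow> real" where
  "riemannian_dist M A g p q =
     Inf {len. \<exists>\<gamma>. piecewise_C1_curve M A \<gamma> \<and> pathstart \<gamma> = p \<and> pathfinish \<gamma> = q \<and>
                 has_curve_length A g \<gamma> len}"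

definition complete_metric ::
  "'p::topological_space set \<Rightarrow> ('p, 'e::real_normed_vector) chart set \<Rightarrow>
     ('p, 'e) bilinear_field \<Rightarrow> bool" where
  "complete_metric M A g \<longleftrightarrow>
     (\<forall>s::nat \<Rightarrow> 'p. range s \<subseteq> M \<and>
        (\<forall>\<epsilon>>0. \<exists>N. \<forall>m\<ge>N. \<forall>m'\<ge>N. riemannian_dist M A g (s m) (s m') < \<epsilon>) \<longrightarrow>
        (\<exists>q\<in>M. (\<lambda>m. riemannian_dist M A g (s m) q) \<longlonglongrightarrow> 0))"

section \<open>The manifold \<open>\<real>\<^sup>2 \<times> T\<^sup>n\<^sup>-\<^sup>2\<close>\<close>

text \<open>
  Let \<open>k = CARD('k)\<close> and \<open>n = 2 + 2 k\<close>. The \<open>n - 2\<close> indices of the torus coordinates form the type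
  \<open>'k + 'k\<close>: \<open>\<theta>\<^sup>j\<close> is the coordinate with index \<open>Inl j\<close> and \<open>\<theta>\<^sup>k\<^sup>+\<^sup>j\<close> the one with index \<open>Inr j\<close>.

  A point of the manifold is a pair \<open>(z, w)\<close>. Its second entry lies on the torus, a product of unit
  circles, the angle with period \<open>L $ i\<close> being encoded as \<open>w $ i = cis (2 * pi * \<theta> $ i / L $ i)\<close>.
  Its first entry labels a point of the plane by \<open>z = (r - rp) * cis \<Phi>\<close>, so that \<open>r = rp\<close> is
  \<open>z = 0\<close>. This labelling carries only the topology: the smooth structure is the one given by the
  two families of charts below, not the standard one of \<open>z\<close>.
\<close>

type_synonym 'k point = "complex \<times> (complex ^ ('k + 'k))"

type_synonym 'k coords = "real \<times> real \<times> (real ^ ('k + 'k))"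

definition V :: "nat \<Rightarrow> real \<Rightarrow> real \<Rightarrow> real \<Rightarrow> real \<Rightarrow> real" where
  "V n l r0 a r = r ^ 2 / l ^ 2 * (1 + a / r ^ (n - 1) - r0 ^ n / r ^ n)"

definition largest_positive_root :: "(real \<Rightarrow> real) \<Rightarrow> real \<Rightarrow> bool" where
  "largest_positive_root f x \<longleftrightarrow> 0 < x \<and> f x = 0 \<and> (\<forall>y>0. f y = 0 \<longrightarrow> y \<le> x)"

definition plane_times_torus :: "'k::finite point set" where
  "plane_times_torus = {(z, w). \<forall>i. norm (w $ i) = 1}"

definition radius :: "real \<Rightarrow> 'k::finite point \<Rightarrow> real" where
  "radius rp p = rp + norm (fst p)"

definition is_polar_angle :: "complex \<Rightarrow> real \<Rightarrow> bool" where
  "is_polar_angle z \<Phi> \<longleftrightarrow> z = rcis (norm z) \<Phi>"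

definition is_torus_coord ::
  "real ^ ('k::finite + 'k) \<Rightarrow> complex ^ ('k + 'k) \<Rightarrow> real ^ ('k + 'k) \<Rightarrow> bool" where
  "is_torus_coord L w \<theta> \<longleftrightarrow> (\<forall>i. w $ i = cis (2 * pi * \<theta> $ i / L $ i))"

text \<open>The charts \<open>(r, \<phi>, \<theta>)\<close> on open subsets of \<open>r > rp\<close>, for all branches of \<open>\<phi>\<close> and \<open>\<theta>\<close>.\<close>

definition polar_charts ::
  "real \<Rightarrow> real \<Rightarrow> real ^ ('k::finite + 'k) \<Rightarrow> ('k point, 'k coords) chart set" where
  "polar_charts rp \<beta> L =
     {\<kappa>. is_chart plane_times_torus \<kappa> \<and>
         (\<forall>p\<in>cdom \<kappa>. rp < radius rp p \<and>
            (\<exists>\<phi> \<theta>. is_polar_angle (fst p) (2 * pi * \<phi> / \<beta>) \<and> is_torus_coord L (snd p) \<theta> \<and>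
                   cmap \<kappa> p = (radius rp p, \<phi>, \<theta>)))}"

text \<open>
  The charts \<open>(x, y, \<theta>)\<close> with \<open>x = \<rho> cos \<Phi>\<close>, \<open>y = \<rho> sin \<Phi>\<close>, \<open>\<rho> = sqrt (V r)\<close>. In general
  \<open>V\<close> need not be monotone far from \<open>rp\<close>, so \<open>\<rho>\<close> can be used only near \<open>r = rp\<close>: the domains are
  contained in the region where \<open>V' > 0\<close> holds all the way from \<open>rp\<close> to \<open>r\<close>.
\<close>

definition core_charts ::
  "(real \<Rightarrow> real) \<Rightarrow> real \<Rightarrow> real ^ ('k::finite + 'k) \<Rightarrow> ('k point, 'k coords) chart set" where
  "core_charts f rp L =
     {\<kappa>. is_chart plane_times_torus \<kappa> \<and>
         (\<forall>p\<in>cdom \<kappa>. (\<forall>s\<in>{rp..radius rp p}. 0 < deriv f s) \<and>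
            (\<exists>\<Phi> \<theta>. is_polar_angle (fst p) \<Phi> \<and> is_torus_coord L (snd p) \<theta> \<and>
                   (let \<rho> = sqrt (f (radius rp p)) in cmap \<kappa> p = (\<rho> * cos \<Phi>, \<rho> * sin \<Phi>, \<theta>))))}"

definition the_atlas ::
  "(real \<Rightarrow> real) \<Rightarrow> real \<Rightarrow> real \<Rightarrow> real ^ ('k::finite + 'k) \<Rightarrow> ('k point, 'k coords) chart set" where
  "the_atlas f rp \<beta> L = polar_charts rp \<beta> L \<union> core_charts f rp L"

section \<open>The metric and the almost-complex structure on \<open>r > rp\<close>\<close>

text \<open>The coordinate 1-forms of a chart \<open>(r, \<phi>, \<theta>)\<close>, as linear forms on the model space.\<close>

definition dr :: "'k::finite coords \<Rightarrow> real" where "dr v = fst v"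

definition dphi :: "'k::finite coords \<Rightarrow> real" where "dphi v = fst (snd v)"

definition dtheta :: "'k + 'k \<Rightarrow> 'k::finite coords \<Rightarrow> real" where "dtheta i v = snd (snd v) $ i"

definition is_metric_g ::
  "(real \<Rightarrow> real) \<Rightarrow> real \<Rightarrow> real \<Rightarrow> real ^ ('k::finite + 'k) \<Rightarrow> ('k point, 'k coords) bilinear_field \<Rightarrow> bool"
  where
  "is_metric_g f rp \<beta> L g \<longleftrightarrow>
     (\<forall>\<kappa>\<in>polar_charts rp \<beta> L. \<forall>p\<in>cdom \<kappa>. \<forall>v w.
        let r = radius rp p in
          g \<kappa> p v w = 1 / f r * (dr v * dr w) + f r * (dphi v * dphi w)
                       + r ^ 2 * (\<Sum>i\<in>UNIV. dtheta i v * dtheta i w))"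

text \<open>
  \<open>J\<close> acts on 1-forms by \<open>\<alpha> \<mapsto> \<alpha> \<circ> J\<close>. The other convention, \<open>\<alpha> \<mapsto> - (\<alpha> \<circ> J)\<close>, amounts to
  replacing \<open>J\<close> by \<open>- J\<close>.
\<close>

definition act_on_form :: "('e \<Rightarrow> 'e) \<Rightarrow> ('e \<Rightarrow> real) \<Rightarrow> 'e \<Rightarrow> real" where
  "act_on_form T \<alpha> = \<alpha> \<circ> T"

definition is_structure_J ::
  "(real \<Rightarrow> real) \<Rightarrow> real \<Rightarrow> real \<Rightarrow> real ^ ('k::finite + 'k) \<Rightarrow> ('k point, 'k coords) endo_field \<Rightarrow> bool"
  where
  "is_structure_J f rp \<beta> L J \<longleftrightarrow>
     (\<forall>\<kappa>\<in>polar_charts rp \<beta> L. \<forall>p\<in>cdom \<kappa>.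
        act_on_form (J \<kappa> p) (\<lambda>v. 1 / f (radius rp p) * dr v) = dphi \<and>
        (\<forall>j. act_on_form (J \<kappa> p) (dtheta (Inl j)) = dtheta (Inr j)))"

section \<open>Integrability\<close>

definition times_i :: "complex \<times> (complex ^ 'k) \<Rightarrow> complex \<times> (complex ^ 'k::finite)" where
  "times_i v = (\<i> * fst v, \<i> *s snd v)"

text \<open>
  \<open>J\<close> is integrable if it is the almost-complex structure of a complex manifold: around each point
  there is a chart of the smooth structure with values in \<open>\<complex>\<^sup>1\<^sup>+\<^sup>k\<close> whose differential carries \<open>J\<close> to
  multiplication by \<open>\<i>\<close>. (Changes between such charts are then holomorphic.)
\<close>

definition integrable_structure ::
  "'k::finite point set \<Rightarrow> ('k point, 'k coords) chart set \<Rightarrow> ('k point, 'k coords) endo_field \<Rightarrow> bool" where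
  "integrable_structure M A J \<longleftrightarrow>
     (\<forall>p\<in>M. \<exists>\<zeta> :: ('k point, complex \<times> (complex ^ 'k)) chart.
        p \<in> cdom \<zeta> \<and> is_chart M \<zeta> \<and> (\<forall>\<kappa>\<in>A. smoothly_compatible \<kappa> \<zeta>) \<and>
        (\<forall>\<kappa>\<in>A. \<forall>q\<in>cdom \<kappa> \<inter> cdom \<zeta>. \<forall>v.
           dtransition \<kappa> \<zeta> q (J \<kappa> q v) = times_i (dtransition \<kappa> \<zeta> q v)))"

end

theory Submission
  imports Defs
begin

text \<open>
  The idea is to write down complex coordinates. Off the locus \<open>r = rp\<close> the structure \<open>J\<close> carries
  \<open>dr / V\<close> to \<open>d\<phi>\<close> and \<open>d\<theta>\<^sup>j\<close> to \<open>d\<theta>\<^sup>k\<^sup>+\<^sup>j\<close>. Hence, if \<open>dr\<^sub>* = dr / V\<close>, the differentials of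
  \<open>r\<^sub>* - \<i> \<phi>\<close> and of \<open>\<theta>\<^sup>j - \<i> \<theta>\<^sup>k\<^sup>+\<^sup>j\<close> are eigenvectors of \<open>J\<close> with eigenvalue \<open>\<i>\<close>. The tortoise
  coordinate \<open>r\<^sub>*\<close> diverges logarithmically at \<open>r = rp\<close>, so the coordinate used there is
  \<open>W = exp (2 \<pi> (r\<^sub>* - \<i> \<phi>) / \<beta>)\<close>, which is single valued because \<open>\<phi>\<close> has period \<open>\<beta>\<close>. As
  \<open>V' rp = 4 \<pi> / \<beta>\<close>, the function \<open>K = \<bar>W\<bar>\<^sup>2\<close>, which satisfies \<open>K' / K = V' rp / V\<close>, has the form
  \<open>K r = (r - rp) * E r\<close> with \<open>E\<close> smooth and positive up to and slightly beyond \<open>rp\<close>: writing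
  \<open>V r = (r - rp) * Q r\<close>, the equation for \<open>E\<close> is \<open>E' / E = (Q rp - Q r) / ((r - rp) * Q r)\<close>, whose
  right-hand side is regular at \<open>rp\<close> (\<open>V_factor\<close>, \<open>regularising_factor\<close>). Consequently
  \<open>W = sqrt (E r) * cnj q\<close> while the core chart is \<open>x + \<i> y = sqrt (Q r) * q\<close>, where
  \<open>q = sqrt (r - rp) * cis \<Phi>\<close>; so \<open>W\<close> is a smooth coordinate near \<open>r = rp\<close> as well.

  Smoothness of all coordinate changes is organised around the functions \<open>r\<close>, \<open>q\<close> and the
  components of the torus point. In every chart of each of the three families (polar, core,
  holomorphic) these functions are smooth, and conversely the coordinates of every such chart are
  smooth in any parameters in which these functions are smooth and the coordinates continuous. Both
  directions rest on one principle: a continuous \<open>h\<close> for which \<open>F \<circ> h\<close> is smooth is itself smooth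
  wherever \<open>F' \<noteq> 0\<close> (\<open>smooth_on_lift\<close>). It recovers \<open>r\<close> from \<open>x\<^sup>2 + y\<^sup>2 = V r\<close> or from
  \<open>\<bar>W\<bar>\<^sup>2 = K r\<close>, and angles, whatever their branch, from points of the circle.

  In polar charts both conclusions are short computations with 1-forms (\<open>J_holo_polar\<close>,
  \<open>metric_compatible_polar\<close>). The transformation laws of \<open>J\<close> and \<open>g\<close> carry them to core charts
  where \<open>r > rp\<close>, and since \<open>r = rp\<close> is nowhere dense in a core chart, they extend by continuity
  (\<open>continuous_eq_zero_off_hyperplane\<close>).
\<close>

section \<open>Calculus of smooth maps\<close>

lemma frechet_derivative_cong_open:
  assumes "open S" "x \<in> S" "\<And>y. y \<in> S \<Longrightarrow> f y = g y" "f differentiable (at x)"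
  shows "g differentiable (at x)" "frechet_derivative g (at x) = frechet_derivative f (at x)"
proof -
  have "(f has_derivative frechet_derivative f (at x)) (at x)"
    using assms(4) by (simp add: frechet_derivative_works)
  then have *: "(g has_derivative frechet_derivative f (at x)) (at x)"
    by (rule has_derivative_transform_within_open[OF _ assms(1,2)]) (use assms(3) in auto)
  show "g differentiable (at x)" using * by (auto simp: differentiable_def)
  show "frechet_derivative g (at x) = frechet_derivative f (at x)"
    using frechet_derivative_at[OF *] by simp
qed

lemma Ck_on_cong:
  assumes "open S" "\<And>x. x \<in> S \<Longrightarrow> f x = g x" "Ck_on S f m"
  shows "Ck_on S g m"
  using assms(2,3)
proof (induction m arbitrary: f g)
  case 0
  then show ?case by (auto cong: continuous_on_cong)
next
  case (Suc m)
  have fd: "\<And>x. x \<in> S \<Longrightarrow> f differentiable (at x)" using Suc.prems(2) by simp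
  note c = frechet_derivative_cong_open[OF assms(1) _ Suc.prems(1) fd]
  show ?case
    using Suc.prems(2) c Suc.IH[of "\<lambda>x. frechet_derivative f (at x) v"
        "\<lambda>x. frechet_derivative g (at x) v" for v]
    by auto
qed

lemma Ck_on_SucI:
  assumes "open S" "\<And>x. x \<in> S \<Longrightarrow> (f has_derivative f' x) (at x)" "\<And>v. Ck_on S (\<lambda>x. f' x v) m"
  shows "Ck_on S f (Suc m)"
proof -
  have *: "f' x = frechet_derivative f (at x)" if "x \<in> S" for x
    using frechet_derivative_at[OF assms(2)[OF that]] .
  show ?thesis
    using assms(2) Ck_on_cong[OF assms(1) _ assms(3)] * by (auto simp: differentiable_def)
qed

lemma Ck_on_SucD:
  assumes "Ck_on S f (Suc m)" shows "Ck_on S f m"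
  using assms
proof (induction m arbitrary: f)
  case 0
  then show ?case
    by (simp add: continuous_at_imp_continuous_on differentiable_imp_continuous_within)
next
  case (Suc m)
  then show ?case by (metis Ck_on.simps(2))
qed

lemma Ck_on_has_derivative:
  "Ck_on S f (Suc m) \<Longrightarrow> x \<in> S \<Longrightarrow> (f has_derivative frechet_derivative f (at x)) (at x)"
  by (simp add: frechet_derivative_works)

lemma Ck_on_subset: "Ck_on S f m \<Longrightarrow> T \<subseteq> S \<Longrightarrow> Ck_on T f m"
  by (induction m arbitrary: f) (auto intro: continuous_on_subset)

lemma Ck_on_const: "Ck_on S (\<lambda>x. c) m"
  by (induction m arbitrary: c) (auto simp: frechet_derivative_const)

lemma Ck_on_bounded_linear:
  assumes "bounded_linear h" "open S" "Ck_on S f m"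
  shows "Ck_on S (\<lambda>x. h (f x)) m"
  using assms(3)
proof (induction m arbitrary: f)
  case 0
  then show ?case using assms(1) by (simp add: bounded_linear.continuous_on)
next
  case (Suc m)
  show ?case
  proof (rule Ck_on_SucI[OF assms(2)])
    show "((\<lambda>x. h (f x)) has_derivative (\<lambda>v. h (frechet_derivative f (at x) v))) (at x)"
      if "x \<in> S" for x
      by (rule bounded_linear.has_derivative[OF assms(1) Ck_on_has_derivative[OF Suc.prems that]])
    show "Ck_on S (\<lambda>x. h (frechet_derivative f (at x) v)) m" for v
      using Suc by auto
  qed
qed

lemma Ck_on_id: "open S \<Longrightarrow> Ck_on S (\<lambda>x. x) m"
proof (cases m)
  case (Suc k)
  assume "open S"
  then show ?thesis unfolding Suc
    by (intro Ck_on_SucI[where f' = "\<lambda>x v. v"]) (auto intro: Ck_on_const)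
qed auto

lemma Ck_on_add:
  assumes "open S" "Ck_on S f m" "Ck_on S g m"
  shows "Ck_on S (\<lambda>x. f x + g x) m"
  using assms(2,3)
proof (induction m arbitrary: f g)
  case 0
  then show ?case by (simp add: continuous_on_add)
next
  case (Suc m)
  show ?case
    by (rule Ck_on_SucI[OF assms(1) has_derivative_add[OF Ck_on_has_derivative[OF Suc.prems(1)]
            Ck_on_has_derivative[OF Suc.prems(2)]]]) (use Suc in auto)
qed

lemma Ck_on_sum:
  assumes "open S" "\<And>i. i \<in> I \<Longrightarrow> Ck_on S (f i) m"
  shows "Ck_on S (\<lambda>x. \<Sum>i\<in>I. f i x) m"
  using assms(2)
  by (induction I rule: infinite_finite_induct) (auto intro: Ck_on_const Ck_on_add[OF assms(1)])

lemma Ck_on_bilinear: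
  assumes "bounded_bilinear h" "open S" "Ck_on S f m" "Ck_on S g m"
  shows "Ck_on S (\<lambda>x. h (f x) (g x)) m"
  using assms(3,4)
proof (induction m arbitrary: f g)
  case 0
  then show ?case using assms(1) by (simp add: bounded_bilinear.continuous_on)
next
  case (Suc m)
  show ?case
  proof (rule Ck_on_SucI[OF assms(2) bounded_bilinear.FDERIV[OF assms(1)
      Ck_on_has_derivative[OF Suc.prems(1)] Ck_on_has_derivative[OF Suc.prems(2)]]])
    show "Ck_on S (\<lambda>x. h (f x) (frechet_derivative g (at x) v) +
        h (frechet_derivative f (at x) v) (g x)) m" for v
      using Suc Ck_on_SucD[OF Suc.prems(1)] Ck_on_SucD[OF Suc.prems(2)]
      by (intro Ck_on_add assms(2) Suc.IH) auto
  qed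
qed

text \<open>
  The derivative of the inner map is expanded in the standard basis. This reduces the derivative
  of the composition to products of directional derivatives, which is the form that the
  definition of \<open>Ck_on\<close>, with its fixed directions, can handle.
\<close>

lemma Ck_on_compose:
  fixes f :: "'b::euclidean_space \<Rightarrow> 'c::real_normed_vector"
  assumes "open S" "Ck_on T f m" "Ck_on S g m" "g ` S \<subseteq> T"
  shows "Ck_on S (\<lambda>x. f (g x)) m"
  using assms(2,3)
proof (induction m arbitrary: f)
  case 0
  then show ?case using assms(4) by (auto intro: continuous_on_compose2)
next
  case (Suc m)
  show ?case
  proof (rule Ck_on_SucI[OF assms(1)])
    fix x assume x: "x \<in> S"
    let ?g' = "frechet_derivative g (at x)"
    let ?f' = "frechet_derivative f (at (g x))"
    have g': "(g has_derivative ?g') (at x)" using Ck_on_has_derivative[OF Suc.prems(2) x] .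
    have f': "(f has_derivative ?f') (at (g x))"
      using Ck_on_has_derivative[OF Suc.prems(1)] x assms(4) by auto
    have "((\<lambda>x. f (g x)) has_derivative (\<lambda>v. ?f' (?g' v))) (at x)"
      by (rule has_derivative_compose[OF g' f'])
    moreover have "?f' (?g' v) = (\<Sum>b\<in>Basis. (?g' v \<bullet> b) *\<^sub>R ?f' b)" for v
    proof -
      have lin: "linear ?f'" using f' has_derivative_linear by blast
      have "?f' (?g' v) = ?f' (\<Sum>b\<in>Basis. (?g' v \<bullet> b) *\<^sub>R b)" by (simp add: euclidean_representation)
      also have "\<dots> = (\<Sum>b\<in>Basis. (?g' v \<bullet> b) *\<^sub>R ?f' b)"
        by (simp add: linear_sum[OF lin] linear_scale[OF lin])
      finally show ?thesis .
    qed
    ultimately show "((\<lambda>x. f (g x)) has_derivative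
      (\<lambda>v. \<Sum>b\<in>Basis. (frechet_derivative g (at x) v \<bullet> b) *\<^sub>R frechet_derivative f (at (g x)) b)) (at x)"
      by simp
  next
    fix v
    show "Ck_on S (\<lambda>x. \<Sum>b\<in>Basis. (frechet_derivative g (at x) v \<bullet> b) *\<^sub>R
           frechet_derivative f (at (g x)) b) m"
    proof (intro Ck_on_sum Ck_on_bilinear[OF bounded_bilinear_scaleR] assms(1))
      show "Ck_on S (\<lambda>x. frechet_derivative g (at x) v \<bullet> b) m" for b
        by (rule Ck_on_bounded_linear[OF bounded_linear_inner_left assms(1)]) (use Suc.prems in auto)
      show "Ck_on S (\<lambda>x. frechet_derivative f (at (g x)) b) m" for b
        using Suc.IH[of "\<lambda>y. frechet_derivative f (at y) b"] Suc.prems Ck_on_SucD[OF Suc.prems(2)]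
        by auto
    qed
  qed
qed

lemma Ck_on_local:
  assumes "\<And>x. x \<in> S \<Longrightarrow> \<exists>U. open U \<and> x \<in> U \<and> Ck_on U f m"
  shows "Ck_on S f m"
  using assms
proof (induction m arbitrary: f)
  case 0
  show ?case
    unfolding Ck_on.simps
  proof (rule continuous_at_imp_continuous_on, rule ballI)
    fix x assume "x \<in> S"
    from 0[OF this] show "isCont f x" by (auto simp: continuous_on_eq_continuous_at)
  qed
next
  case (Suc m)
  have "f differentiable (at x)" if "x \<in> S" for x using Suc.prems[OF that] by auto
  moreover have "Ck_on S (\<lambda>x. frechet_derivative f (at x) v) m" for v
    by (rule Suc.IH) (use Suc.prems in fastforce)
  ultimately show ?case by simp
qed

lemma smooth_on_cong: "open S \<Longrightarrow> (\<And>x. x \<in> S \<Longrightarrow> f x = g x) \<Longrightarrow> smooth_on S f \<Longrightarrow> smooth_on S g"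
  unfolding smooth_on_def using Ck_on_cong by blast

lemma smooth_on_subset: "smooth_on S f \<Longrightarrow> T \<subseteq> S \<Longrightarrow> smooth_on T f"
  unfolding smooth_on_def using Ck_on_subset by blast

lemma smooth_on_const: "smooth_on S (\<lambda>x. c)"
  unfolding smooth_on_def using Ck_on_const by blast

lemma smooth_on_id: "open S \<Longrightarrow> smooth_on S (\<lambda>x. x)"
  unfolding smooth_on_def using Ck_on_id by blast

lemma smooth_on_bounded_linear:
  "bounded_linear h \<Longrightarrow> open S \<Longrightarrow> smooth_on S f \<Longrightarrow> smooth_on S (\<lambda>x. h (f x))"
  by (simp add: smooth_on_def Ck_on_bounded_linear)

lemma smooth_on_add:
  "open S \<Longrightarrow> smooth_on S f \<Longrightarrow> smooth_on S g \<Longrightarrow> smooth_on S (\<lambda>x. f x + g x)"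
  unfolding smooth_on_def using Ck_on_add by blast

lemma smooth_on_sum:
  "open S \<Longrightarrow> (\<And>i. i \<in> I \<Longrightarrow> smooth_on S (f i)) \<Longrightarrow> smooth_on S (\<lambda>x. \<Sum>i\<in>I. f i x)"
  by (simp add: smooth_on_def Ck_on_sum)

lemma smooth_on_bilinear:
  "bounded_bilinear h \<Longrightarrow> open S \<Longrightarrow> smooth_on S f \<Longrightarrow> smooth_on S g \<Longrightarrow>
    smooth_on S (\<lambda>x. h (f x) (g x))"
  by (simp add: smooth_on_def Ck_on_bilinear)

lemma smooth_on_diff:
  "open S \<Longrightarrow> smooth_on S f \<Longrightarrow> smooth_on S g \<Longrightarrow> smooth_on S (\<lambda>x. f x - g x)"
  unfolding diff_conv_add_uminus
  by (intro smooth_on_add smooth_on_bounded_linear[OF bounded_linear_minus[OF bounded_linear_ident]])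

lemma smooth_on_mult:
  fixes f g :: "'a::real_normed_vector \<Rightarrow> 'b::real_normed_algebra"
  shows "open S \<Longrightarrow> smooth_on S f \<Longrightarrow> smooth_on S g \<Longrightarrow> smooth_on S (\<lambda>x. f x * g x)"
  by (rule smooth_on_bilinear[OF bounded_bilinear_mult])

lemma smooth_on_scaleR:
  "open S \<Longrightarrow> smooth_on S f \<Longrightarrow> smooth_on S g \<Longrightarrow> smooth_on S (\<lambda>x. f x *\<^sub>R g x)"
  by (rule smooth_on_bilinear[OF bounded_bilinear_scaleR])

lemma smooth_on_compose:
  fixes f :: "'b::euclidean_space \<Rightarrow> 'c::real_normed_vector"
  shows "open S \<Longrightarrow> smooth_on T f \<Longrightarrow> smooth_on S g \<Longrightarrow> g ` S \<subseteq> T \<Longrightarrow> smooth_on S (\<lambda>x. f (g x))"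
  by (simp add: smooth_on_def Ck_on_compose[where T = T])

lemma smooth_on_local:
  assumes "\<And>x. x \<in> S \<Longrightarrow> \<exists>U. open U \<and> x \<in> U \<and> smooth_on U f"
  shows "smooth_on S f"
  unfolding smooth_on_def
proof
  show "Ck_on S f m" for m
    by (rule Ck_on_local) (use assms in \<open>auto simp: smooth_on_def\<close>)
qed

lemma smooth_on_imp_continuous_on: "smooth_on S f \<Longrightarrow> continuous_on S f"
  unfolding smooth_on_def using Ck_on.simps(1) by blast

lemma smooth_on_has_derivative:
  "smooth_on S f \<Longrightarrow> x \<in> S \<Longrightarrow> (f has_derivative frechet_derivative f (at x)) (at x)"
  unfolding smooth_on_def using Ck_on_has_derivative by blast

lemma smooth_on_frechet_derivative:
  "smooth_on S f \<Longrightarrow> smooth_on S (\<lambda>x. frechet_derivative f (at x) v)"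
  unfolding smooth_on_def by (metis Ck_on.simps(2))

lemma smooth_on_has_real_derivative:
  fixes f :: "real \<Rightarrow> real"
  assumes "smooth_on S f" "x \<in> S"
  shows "(f has_real_derivative deriv f x) (at x)"
  using smooth_on_has_derivative[OF assms] 
  by (metis DERIV_deriv_iff_real_differentiable differentiable_def)

lemma smooth_on_Pair:
  assumes "open S" "smooth_on S f" "smooth_on S g"
  shows "smooth_on S (\<lambda>x. (f x, g x))"
proof -
  have "smooth_on S (\<lambda>x. (f x, 0) + (0, g x))"
    using smooth_on_bounded_linear[OF bounded_linear_Pair[OF bounded_linear_ident bounded_linear_zero] assms(1,2)]
       smooth_on_bounded_linear[OF bounded_linear_Pair[OF bounded_linear_zero bounded_linear_ident] assms(1,3)]
    by (intro smooth_on_add assms(1)) auto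
  then show ?thesis by simp
qed

lemma smooth_on_vec:
  fixes f :: "'i::finite \<Rightarrow> 'a::real_normed_vector \<Rightarrow> 'b::real_normed_vector"
  assumes "open S" "\<And>i. smooth_on S (f i)"
  shows "smooth_on S (\<lambda>x. \<chi> i. f i x)"
proof -
  have lin: "bounded_linear (axis i :: 'b \<Rightarrow> 'b ^ 'i)" for i
  proof (rule bounded_linear_intro[where K = 1])
    fix x :: 'b
    have "(norm ((axis i x :: 'b ^ 'i) $ j))\<^sup>2 = (if j = i then (norm x)\<^sup>2 else 0)" for j
      by (simp add: axis_def)
    then show "norm (axis i x :: 'b ^ 'i) \<le> norm x * 1"
      by (simp add: norm_vec_def L2_set_def)
  qed (auto simp: axis_def vec_eq_iff)
  have "smooth_on S (\<lambda>x. \<Sum>i\<in>UNIV. axis i (f i x))"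
    by (intro smooth_on_sum assms(1) smooth_on_bounded_linear[OF lin] assms(2))
  moreover have "(\<Sum>i\<in>UNIV. axis i (f i x)) = (\<chi> i. f i x)" for x
    by (simp add: vec_eq_iff axis_def)
  ultimately show ?thesis by simp
qed

lemma Ck_on_real_SucI:
  fixes f :: "real \<Rightarrow> 'b::real_normed_vector"
  assumes "open S" "\<And>x. x \<in> S \<Longrightarrow> (f has_vector_derivative f' x) (at x)" "Ck_on S f' m"
  shows "Ck_on S f (Suc m)"
proof (rule Ck_on_SucI[OF assms(1)])
  show "(f has_derivative (\<lambda>v. v *\<^sub>R f' x)) (at x)" if "x \<in> S" for x
    using assms(2)[OF that] by (simp add: has_vector_derivative_def)
  show "Ck_on S (\<lambda>x. v *\<^sub>R f' x) m" for v
    by (rule Ck_on_bounded_linear[OF bounded_linear_scaleR_right assms(1,3)])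
qed

text \<open>
  Elementary functions are smooth because their derivatives are expressions in functions already
  known to be of class \<open>C\<^sup>m\<close>; this is the step from \<open>m\<close> to \<open>m + 1\<close>.
\<close>

lemma smooth_on_real_antiderivative:
  fixes f :: "real \<Rightarrow> 'b::real_normed_vector"
  assumes "open S" "\<And>x. x \<in> S \<Longrightarrow> (f has_vector_derivative f' x) (at x)" "smooth_on S f'"
  shows "smooth_on S f"
  using Ck_on_real_SucI[OF assms(1,2)] assms(3) Ck_on_SucD unfolding smooth_on_def by blast

lemma Ck_on_inverse_real:
  "Ck_on (- {0}) (inverse :: real \<Rightarrow> real) m"
proof (induction m)
  case 0
  then show ?case by (auto intro!: continuous_intros)
next
  case (Suc m)
  have o: "open (- {0 :: real})" by auto
  show ?case
  proof (rule Ck_on_real_SucI[OF o])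
    show "(inverse has_vector_derivative - (inverse x * inverse x)) (at x)" if "x \<in> - {0}" for x :: real
      using DERIV_inverse'[OF DERIV_ident, of x UNIV] that
      by (simp add: has_real_derivative_iff_has_vector_derivative algebra_simps)
    show "Ck_on (- {0}) (\<lambda>x::real. - (inverse x * inverse x)) m"
      by (intro Ck_on_bounded_linear[OF bounded_linear_minus[OF bounded_linear_ident]]
            Ck_on_bilinear[OF bounded_bilinear_mult] o Suc.IH)
  qed
qed

lemma smooth_on_inverse:
  fixes f :: "'a::real_normed_vector \<Rightarrow> real"
  assumes "open S" "smooth_on S f" "\<And>x. x \<in> S \<Longrightarrow> f x \<noteq> 0"
  shows "smooth_on S (\<lambda>x. inverse (f x))"
  by (rule smooth_on_compose[OF assms(1) _ assms(2), where T = "- {0}"])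
     (use assms(3) Ck_on_inverse_real in \<open>auto simp: smooth_on_def\<close>)

lemma smooth_on_divide:
  fixes f g :: "'a::real_normed_vector \<Rightarrow> real"
  assumes "open S" "smooth_on S f" "smooth_on S g" "\<And>x. x \<in> S \<Longrightarrow> g x \<noteq> 0"
  shows "smooth_on S (\<lambda>x. f x / g x)"
  using smooth_on_mult[OF assms(1,2) smooth_on_inverse[OF assms(1,3,4)]] by (simp add: field_simps)

lemma Ck_on_sqrt: "Ck_on {0<..} sqrt m"
proof (induction m)
  case 0
  then show ?case by (auto intro!: continuous_intros)
next
  case (Suc m)
  show ?case
  proof (rule Ck_on_real_SucI)
    show "(sqrt has_vector_derivative inverse (sqrt x) *\<^sub>R (1 / 2)) (at x)" if "x \<in> {0<..}" for x
      using DERIV_real_sqrt[of x] that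
      by (simp add: has_real_derivative_iff_has_vector_derivative)
    show "Ck_on {0<..} (\<lambda>x. inverse (sqrt x) *\<^sub>R (1 / 2)) m"
      by (intro Ck_on_bounded_linear[OF bounded_linear_scaleR_left]
          Ck_on_compose[OF _ Ck_on_inverse_real Suc.IH]) auto
  qed simp
qed

lemma smooth_on_sqrt:
  fixes f :: "'a::real_normed_vector \<Rightarrow> real"
  assumes "open S" "smooth_on S f" "\<And>x. x \<in> S \<Longrightarrow> f x > 0"
  shows "smooth_on S (\<lambda>x. sqrt (f x))"
  by (rule smooth_on_compose[OF assms(1) _ assms(2), where T = "{0<..}"])
     (use assms(3) Ck_on_sqrt in \<open>auto simp: smooth_on_def\<close>)

lemma Ck_on_exp: "Ck_on UNIV (exp :: real \<Rightarrow> real) m"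
proof (induction m)
  case 0
  then show ?case by (auto intro!: continuous_intros)
next
  case (Suc m)
  show ?case
    by (rule Ck_on_real_SucI[OF _ _ Suc])
      (auto simp flip: has_real_derivative_iff_has_vector_derivative)
qed

lemma smooth_on_exp:
  fixes f :: "'a::real_normed_vector \<Rightarrow> real"
  assumes "open S" "smooth_on S f"
  shows "smooth_on S (\<lambda>x. exp (f x))"
  by (rule smooth_on_compose[OF assms(1) _ assms(2), where T = UNIV])
     (use Ck_on_exp in \<open>auto simp: smooth_on_def\<close>)

lemma has_vector_derivative_cis: "(cis has_vector_derivative \<i> * cis x) (at x)"
  using has_derivative_cis[OF has_derivative_ident, of x UNIV]
  by (simp add: has_vector_derivative_def scaleR_conv_of_real mult.commute mult.left_commute)

lemma Ck_on_cis: "Ck_on UNIV cis m"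
proof (induction m)
  case 0
  then show ?case by (auto intro!: continuous_intros)
next
  case (Suc m)
  show ?case
    by (rule Ck_on_real_SucI[OF _ has_vector_derivative_cis])
       (auto intro!: Ck_on_bounded_linear[OF bounded_linear_mult_right] Suc)
qed

lemma smooth_on_cis:
  fixes f :: "'a::real_normed_vector \<Rightarrow> real"
  assumes "open S" "smooth_on S f"
  shows "smooth_on S (\<lambda>x. cis (f x))"
  by (rule smooth_on_compose[OF assms(1) _ assms(2), where T = UNIV])
     (use Ck_on_cis in \<open>auto simp: smooth_on_def\<close>)

lemma Ck_on_poly: "open S \<Longrightarrow> Ck_on S (poly p) m" for p :: "real poly"
proof (induction m arbitrary: p)
  case 0
  then show ?case by (auto intro!: continuous_intros)
next
  case (Suc m)
  show ?case
    by (rule Ck_on_real_SucI[OF Suc.prems _ Suc.IH[OF Suc.prems, of "pderiv p"]])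
      (auto simp flip: has_real_derivative_iff_has_vector_derivative)
qed

lemma smooth_on_poly: "open S \<Longrightarrow> smooth_on S (poly p)" for p :: "real poly"
  unfolding smooth_on_def using Ck_on_poly by blast

section \<open>Smoothness of continuous lifts\<close>

lemma frechet_derivative_real:
  fixes F :: "real \<Rightarrow> real"
  assumes "F differentiable (at t)"
  shows "frechet_derivative F (at t) 1 = deriv F t"
proof -
  have "(F has_real_derivative deriv F t) (at t)"
    using assms DERIV_deriv_iff_real_differentiable by blast
  then have "(F has_derivative (\<lambda>x. deriv F t * x)) (at t)" by (simp add: has_field_derivative_def)
  from frechet_derivative_at[OF this, symmetric] show ?thesis by simp
qed

text \<open>
  Near \<open>h x\<close> the function \<open>F\<close> has a differentiable local inverse \<open>G\<close>, and continuity of \<open>h\<close> makes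
  \<open>h = G \<circ> (F \<circ> h)\<close> hold near \<open>x\<close>.
\<close>

lemma has_derivative_lift:
  fixes h :: "'a::real_normed_vector \<Rightarrow> real" and F :: "real \<Rightarrow> real"
  assumes T: "open T" and F: "smooth_on T F" and S: "open S" "x \<in> S"
    and h: "continuous_on S h" "h x \<in> T" and nz: "deriv F (h x) \<noteq> 0"
    and u: "((\<lambda>y. F (h y)) has_derivative u') (at x)"
  shows "(h has_derivative (\<lambda>v. inverse (deriv F (h x)) * u' v)) (at x)"
proof -
  let ?d = "deriv F (h x)"
  have cF: "continuous_on T (deriv F)"
  proof -
    have "continuous_on T (\<lambda>t. frechet_derivative F (at t) 1)"
      by (rule smooth_on_imp_continuous_on[OF smooth_on_frechet_derivative[OF F]])
    then show ?thesis
      by (subst continuous_on_cong[OF refl frechet_derivative_real[symmetric]])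
        (use smooth_on_has_derivative[OF F] in \<open>auto simp: differentiable_def\<close>)
  qed
  have "continuous_on T (\<lambda>t. deriv F t * ?d)" by (intro continuous_intros cF)
  moreover have "0 < ?d * ?d" using nz by (metis not_real_square_gt_zero)
  moreover have "open (T \<inter> (\<lambda>t. deriv F t * ?d) -` {0<..})"
    if "continuous_on T (\<lambda>t. deriv F t * ?d)"
    using continuous_open_preimage[OF that T] by simp
  ultimately obtain e where e: "e > 0" "ball (h x) e \<subseteq> T \<inter> (\<lambda>t. deriv F t * ?d) -` {0<..}"
    using h(2) by (metis (no_types, lifting) IntI greaterThan_iff open_contains_ball vimageI)
  let ?B = "ball (h x) e"
  have B: "0 < deriv F t * ?d" "t \<in> T" if "t \<in> ?B" for t using e(2) that by auto
  have Fd: "(F has_real_derivative deriv F t) (at t)" if "t \<in> ?B" for t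
    by (rule smooth_on_has_real_derivative[OF F B(2)[OF that]])
  have inj: "inj_on F ?B"
  proof (rule linorder_inj_onI)
    fix s t assume st: "s < t" "s \<in> ?B" "t \<in> ?B"
    have mem: "y \<in> ?B" if "s \<le> y" "y \<le> t" for y
      using st that by (auto simp: dist_real_def)
    obtain z where z: "s < z" "z < t" "F t - F s = (t - s) * deriv F z"
      using MVT2[OF st(1), of F "deriv F"] Fd[OF mem] by auto
    have "deriv F z \<noteq> 0" using B(1)[OF mem[of z]] z by auto
    with z st show "F s \<noteq> F t" by auto
  qed (auto simp: linear)
  have gd: "(inv_into ?B F has_real_derivative inverse ?d) (at (F (h x)))"
    unfolding has_field_derivative_def
  proof (rule has_derivative_inverse_strong[where S = ?B and f = F and x = "h x" and f' = "(*) ?d"])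
    show "(F has_derivative (*) ?d) (at (h x))"
      using Fd[of "h x"] e(1) by (simp add: has_field_derivative_def)
    show "continuous_on ?B F"
      using Fd by (meson DERIV_isCont continuous_at_imp_continuous_on)
    show "(*) ?d \<circ> (*) (inverse ?d) = id" using nz by (auto simp: fun_eq_iff)
  qed (use e inj in auto)
  have comp: "((\<lambda>y. inv_into ?B F (F (h y))) has_derivative (\<lambda>v. inverse ?d * u' v)) (at x)"
    using has_derivative_compose[OF u gd[unfolded has_field_derivative_def]] .
  have op: "open (S \<inter> h -` ?B)" using continuous_open_preimage[OF h(1) S(1)] by auto
  show ?thesis
    by (rule has_derivative_transform_within_open[OF comp op]) (use S e inj in auto)
qed

text \<open>
  The formula for the derivative of \<open>h\<close> contains \<open>h\<close> itself only through \<open>F' (h x)\<close>, so that one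
  gains one order of differentiability at a time. The argument is local in the target, so that it
  applies to \<open>V\<close>, which need not be monotone.
\<close>

lemma smooth_on_lift:
  fixes h :: "'a::real_normed_vector \<Rightarrow> real" and F :: "real \<Rightarrow> real"
  assumes T: "open T" and F: "smooth_on T F" and S: "open S"
    and h: "continuous_on S h" "h ` S \<subseteq> T" and nz: "\<And>x. x \<in> S \<Longrightarrow> deriv F (h x) \<noteq> 0"
    and u: "smooth_on S (\<lambda>y. F (h y))"
  shows "smooth_on S h"
proof -
  have "Ck_on S h m" for m
  proof (induction m)
    case (Suc m)
    let ?u' = "\<lambda>x. frechet_derivative (\<lambda>y. F (h y)) (at x)"
    show ?case
    proof (rule Ck_on_SucI[OF S])
      show "(h has_derivative (\<lambda>v. inverse (deriv F (h x)) * ?u' x v)) (at x)" if "x \<in> S" for x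
        by (rule has_derivative_lift[OF T F S that h(1) _ nz[OF that] smooth_on_has_derivative[OF u that]])
          (use that h(2) in auto)
      have "Ck_on T (\<lambda>t. frechet_derivative F (at t) 1) m"
        using smooth_on_frechet_derivative[OF F] by (auto simp: smooth_on_def)
      then have dF: "Ck_on T (deriv F) m"
        by (rule Ck_on_cong[OF T, rotated], intro frechet_derivative_real)
          (use smooth_on_has_derivative[OF F] in \<open>auto simp: differentiable_def\<close>)
      have "Ck_on S (\<lambda>x. inverse (deriv F (h x))) m"
        by (rule Ck_on_compose[OF S Ck_on_inverse_real Ck_on_compose[OF S dF Suc.IH h(2)]]) (use nz in auto)
      then show "Ck_on S (\<lambda>x. inverse (deriv F (h x)) * ?u' x v) m" for v
        using smooth_on_frechet_derivative[OF u, of v]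
        by (intro Ck_on_bilinear[OF bounded_bilinear_mult S]) (auto simp: smooth_on_def)
    qed
  qed (use h in auto)
  then show ?thesis by (simp add: smooth_on_def)
qed

text \<open>
  A branch of the angle is determined by the point on the circle only up to multiples of \<open>2 \<pi>\<close>;
  continuity fixes it locally. Where \<open>cos (h x) \<noteq> 0\<close> the lifting principle applies to \<open>sin\<close>, where
  \<open>sin (h x) \<noteq> 0\<close> it applies to \<open>cos\<close>.
\<close>

lemma smooth_on_circle_lift:
  fixes h :: "'a::real_normed_vector \<Rightarrow> real"
  assumes S: "open S" and h: "continuous_on S h" and e: "smooth_on S (\<lambda>x. cis (h x))"
  shows "smooth_on S h"
proof -
  have o: "open (UNIV :: real set)" by simp
  have dsin: "deriv sin t = cos t" and dcos: "deriv cos t = - sin t" for t :: real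
    by (auto intro!: DERIV_imp_deriv derivative_eq_intros)
  have ssin: "smooth_on UNIV (sin :: real \<Rightarrow> real)" and scos: "smooth_on UNIV (cos :: real \<Rightarrow> real)"
    using smooth_on_bounded_linear[OF bounded_linear_Im o smooth_on_cis[OF o smooth_on_id[OF o]]]
      smooth_on_bounded_linear[OF bounded_linear_Re o smooth_on_cis[OF o smooth_on_id[OF o]]]
    by simp_all
  have sinh: "smooth_on S (\<lambda>x. sin (h x))" and cosh: "smooth_on S (\<lambda>x. cos (h x))"
    using smooth_on_bounded_linear[OF bounded_linear_Im S e]
      smooth_on_bounded_linear[OF bounded_linear_Re S e] by simp_all
  have "open {t :: real. cos t \<noteq> 0}" "open {t :: real. sin t \<noteq> 0}"
    by (intro open_Collect_neq continuous_intros)+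
  then have oU: "open (S \<inter> h -` {t. cos t \<noteq> 0})" "open (S \<inter> h -` {t. sin t \<noteq> 0})"
    using continuous_open_preimage[OF h S] by blast+
  have 1: "smooth_on (S \<inter> h -` {t. cos t \<noteq> 0}) h"
    by (rule smooth_on_lift[OF o ssin oU(1)])
      (auto simp: dsin intro: continuous_on_subset[OF h] smooth_on_subset[OF sinh])
  have 2: "smooth_on (S \<inter> h -` {t. sin t \<noteq> 0}) h"
    by (rule smooth_on_lift[OF o scos oU(2)])
      (auto simp: dcos intro: continuous_on_subset[OF h] smooth_on_subset[OF cosh])
  show ?thesis
  proof (rule smooth_on_local)
    fix x assume x: "x \<in> S"
    have "cos (h x) \<noteq> 0 \<or> sin (h x) \<noteq> 0" using sin_cos_squared_add[of "h x"] by fastforce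
    then show "\<exists>U. open U \<and> x \<in> U \<and> smooth_on U h"
      using 1 2 oU x by blast
  qed
qed

section \<open>Charts and changes of coordinates\<close>

text \<open>
  An explicit inverse \<open>g\<close> agrees on the image with the inverse selected by \<open>cinv\<close>.
\<close>

lemma is_chartI:
  assumes "openin (top_of_set M) D" "open B" "homeomorphism D B f g"
  shows "is_chart M (D, f)"
proof -
  have B: "f ` D = B" and gB: "g ` B = D" and gf: "\<And>x. x \<in> D \<Longrightarrow> g (f x) = x"
    and fg: "\<And>y. y \<in> B \<Longrightarrow> f (g y) = y"
    using assms(3) by (auto simp: homeomorphism_def)
  have inj: "inj_on f D" by (metis gf inj_onI)
  have "inv_into D f y = g y" if "y \<in> B" for y
    by (rule inv_into_f_eq[OF inj]) (use that gB fg in auto)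
  then have "homeomorphism D B f (inv_into D f)"
    using assms(3) by (metis homeomorphism_cong)
  then show ?thesis using assms B by (simp add: is_chart_def cinv_def)
qed

lemma
  assumes "is_chart M \<kappa>"
  shows is_chart_open_image: "open (cmap \<kappa> ` cdom \<kappa>)"
    and is_chart_continuous: "continuous_on (cdom \<kappa>) (cmap \<kappa>)"
    and is_chart_continuous_inv: "continuous_on (cmap \<kappa> ` cdom \<kappa>) (cinv \<kappa>)"
    and is_chart_inv: "p \<in> cdom \<kappa> \<Longrightarrow> cinv \<kappa> (cmap \<kappa> p) = p"
    and is_chart_subset: "cdom \<kappa> \<subseteq> M"
  using assms by (auto simp: is_chart_def homeomorphism_def openin_subset dest: openin_imp_subset)

lemma cinv_in_dom: "x \<in> cmap \<kappa> ` cdom \<kappa> \<Longrightarrow> cinv \<kappa> x \<in> cdom \<kappa>"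
  by (simp add: cinv_def inv_into_into)

lemma cmap_cinv: "x \<in> cmap \<kappa> ` cdom \<kappa> \<Longrightarrow> cmap \<kappa> (cinv \<kappa> x) = x"
  by (simp add: cinv_def f_inv_into_f)

lemma open_chart_image:
  assumes "is_chart M \<kappa>" "openin (top_of_set M) U" "U \<subseteq> cdom \<kappa>"
  shows "open (cmap \<kappa> ` U)"
proof -
  have "openin (top_of_set (cdom \<kappa>)) U"
    using assms by (meson openin_subset_trans openin_imp_subset is_chart_subset)
  then have "openin (top_of_set (cmap \<kappa> ` cdom \<kappa>)) (cmap \<kappa> ` U)"
    using assms(1) homeomorphism_imp_open_map by (force simp: is_chart_def)
  then show ?thesis using is_chart_open_image[OF assms(1)] openin_open_eq by blast
qed

lemma open_overlap:
  assumes "is_chart M \<kappa>" "is_chart M \<kappa>'"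
  shows "open (cmap \<kappa> ` (cdom \<kappa> \<inter> cdom \<kappa>'))"
  by (rule open_chart_image[OF assms(1)]) (use assms in \<open>auto simp: is_chart_def\<close>)

lemma dtransition_chain:
  assumes c: "is_chart M \<kappa>" "is_chart M \<kappa>'" "is_chart M \<kappa>''"
    and s: "smooth_on (cmap \<kappa> ` (cdom \<kappa> \<inter> cdom \<kappa>')) (transition \<kappa> \<kappa>')"
      "smooth_on (cmap \<kappa>' ` (cdom \<kappa>' \<inter> cdom \<kappa>'')) (transition \<kappa>' \<kappa>'')"
    and p: "p \<in> cdom \<kappa>" "p \<in> cdom \<kappa>'" "p \<in> cdom \<kappa>''"
  shows "dtransition \<kappa> \<kappa>'' p v = dtransition \<kappa>' \<kappa>'' p (dtransition \<kappa> \<kappa>' p v)"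
proof -
  let ?U = "cdom \<kappa> \<inter> cdom \<kappa>' \<inter> cdom \<kappa>''"
  have o: "open (cmap \<kappa> ` ?U)"
    by (rule open_chart_image[OF c(1)]) (use c in \<open>auto simp: is_chart_def\<close>)
  have t: "transition \<kappa> \<kappa>' (cmap \<kappa> q) = cmap \<kappa>' q" if "q \<in> cdom \<kappa>" for q
    using is_chart_inv[OF c(1) that] by (simp add: transition_def)
  have t': "transition \<kappa>' \<kappa>'' (cmap \<kappa>' q) = cmap \<kappa>'' q" if "q \<in> cdom \<kappa>'" for q
    using is_chart_inv[OF c(2) that] by (simp add: transition_def)
  have t'': "transition \<kappa> \<kappa>'' (cmap \<kappa> q) = cmap \<kappa>'' q" if "q \<in> cdom \<kappa>" for q
    using is_chart_inv[OF c(1) that] by (simp add: transition_def)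
  have d1: "(transition \<kappa> \<kappa>' has_derivative dtransition \<kappa> \<kappa>' p) (at (cmap \<kappa> p))"
    unfolding dtransition_def by (rule smooth_on_has_derivative[OF s(1)]) (use p in auto)
  have d2: "(transition \<kappa>' \<kappa>'' has_derivative dtransition \<kappa>' \<kappa>'' p) (at (transition \<kappa> \<kappa>' (cmap \<kappa> p)))"
    unfolding dtransition_def t[OF p(1)] by (rule smooth_on_has_derivative[OF s(2)]) (use p in auto)
  have d3: "(transition \<kappa> \<kappa>'' has_derivative (\<lambda>v. dtransition \<kappa>' \<kappa>'' p (dtransition \<kappa> \<kappa>' p v))) (at (cmap \<kappa> p))"
    by (rule has_derivative_transform_within_open[OF has_derivative_compose[OF d1 d2] o])
      (use p t t' t'' in auto)
  show ?thesis
    using frechet_derivative_at[OF d3] by (metis dtransition_def)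
qed

section \<open>Extension of identities across a hyperplane\<close>

text \<open>
  In finite dimensions, continuity of the operator field in each fixed direction suffices to apply
  it to a continuous vector field.
\<close>

lemma continuous_on_linear_apply:
  fixes B :: "'a::topological_space \<Rightarrow> 'b::euclidean_space \<Rightarrow> 'c::real_normed_vector"
  assumes "\<And>x. x \<in> S \<Longrightarrow> linear (B x)" "\<And>b. continuous_on S (\<lambda>x. B x b)" "continuous_on S u"
  shows "continuous_on S (\<lambda>x. B x (u x))"
proof -
  have eq: "B x (u x) = (\<Sum>b\<in>Basis. (u x \<bullet> b) *\<^sub>R B x b)" if "x \<in> S" for x
  proof -
    have "B x (u x) = B x (\<Sum>b\<in>Basis. (u x \<bullet> b) *\<^sub>R b)" by (simp add: euclidean_representation)
    also have "\<dots> = (\<Sum>b\<in>Basis. (u x \<bullet> b) *\<^sub>R B x b)"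
      using assms(1)[OF that] by (simp add: linear_sum linear_scale)
    finally show ?thesis .
  qed
  have "continuous_on S (\<lambda>x. \<Sum>b\<in>Basis. (u x \<bullet> b) *\<^sub>R B x b)"
    by (intro continuous_intros assms(2,3))
  then show ?thesis by (rule continuous_on_eq) (simp add: eq)
qed

text \<open>
  In a core chart the locus \<open>r = rp\<close> is contained in the hyperplane where the first coordinate
  vanishes; every point of that hyperplane is a limit of points off it.
\<close>

lemma continuous_eq_zero_off_hyperplane:
  fixes F :: "real \<times> 'b::real_normed_vector \<Rightarrow> 'c::real_normed_vector"
  assumes "open S" "continuous_on S F" "\<And>x. x \<in> S \<Longrightarrow> fst x \<noteq> 0 \<Longrightarrow> F x = 0" "x \<in> S"
  shows "F x = 0"
proof (cases "fst x = 0")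
  case True
  let ?c = "\<lambda>t::real. x + (t, 0)"
  have c: "(?c \<longlongrightarrow> x + (0, 0)) (at 0)" by (intro tendsto_intros)
  then have c: "(?c \<longlongrightarrow> x) (at 0)" by (simp flip: zero_prod_def)
  have "isCont F x" using assms(1,2,4) by (simp add: continuous_on_eq_continuous_at)
  then have lim: "((\<lambda>t. F (?c t)) \<longlongrightarrow> F x) (at 0)" using c by (rule isCont_tendsto_compose)
  have "\<forall>\<^sub>F t in at 0. F (?c t) = 0"
    using topological_tendstoD[OF c assms(1,4)] eventually_neq_at_within[of 0 0 UNIV]
    by eventually_elim (use True assms(3) in auto)
  then have "((\<lambda>t. F (?c t)) \<longlongrightarrow> 0) (at 0)" by (rule tendsto_eventually)
  with lim show ?thesis using tendsto_unique trivial_limit_at by blast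
qed (use assms in auto)

section \<open>Branches of the angle\<close>

text \<open>
  The complement of the ray opposite to \<open>u0\<close>, on which the branch \<open>angle_near u0\<close> is continuous.
\<close>

definition slit :: "complex \<Rightarrow> complex set" where
  "slit u0 = {u. u * cnj u0 \<notin> \<real>\<^sub>\<le>\<^sub>0}"

definition angle_near :: "complex \<Rightarrow> complex \<Rightarrow> real" where
  "angle_near u0 u = Arg u0 + Arg (u * cnj u0)"

lemma open_slit: "open (slit u0)"
proof -
  have "closed ((\<lambda>u. u * cnj u0) -` \<real>\<^sub>\<le>\<^sub>0)"
    by (intro closed_vimage continuous_intros closed_nonpos_Reals_complex)
  moreover have "slit u0 = - ((\<lambda>u. u * cnj u0) -` \<real>\<^sub>\<le>\<^sub>0)" by (auto simp: slit_def)
  ultimately show ?thesis by (simp add: open_Compl)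
qed

lemma self_in_slit: "u0 \<noteq> 0 \<Longrightarrow> u0 \<in> slit u0"
  by (simp add: slit_def complex_nonpos_Reals_iff complex_eq_iff)
    (metis add_pos_pos not_square_less_zero not_sum_squares_lt_zero linorder_not_le power2_eq_square sum_power2_le_zero_iff)

lemma continuous_on_angle_near: "continuous_on (slit u0) (angle_near u0)"
  unfolding angle_near_def by (intro continuous_intros) (auto simp: slit_def)

lemma slit_nonzero: "u \<in> slit u0 \<Longrightarrow> u \<noteq> 0 \<and> u0 \<noteq> 0"
  by (auto simp: slit_def)

lemma cis_angle_near:
  assumes "u \<in> slit u0"
  shows "cis (angle_near u0 u) = sgn u"
proof -
  have nz: "u \<noteq> 0" "u0 \<noteq> 0" using slit_nonzero[OF assms] by auto
  have "cis (angle_near u0 u) = sgn u0 * sgn (u * cnj u0)"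
    using nz by (simp add: angle_near_def flip: cis_mult) (simp add: cis_Arg)
  also have "\<dots> = sgn u * sgn (u0 * cnj u0)"
    by (simp add: sgn_mult)
  also have "sgn (u0 * cnj u0) = 1"
    using nz by (simp add: complex_norm_square[symmetric] sgn_of_real del: of_real_power)
  finally show ?thesis by simp
qed

lemma rcis_angle_near: "u \<in> slit u0 \<Longrightarrow> u = rcis (norm u) (angle_near u0 u)"
  using cis_angle_near[of u u0] by (auto simp: rcis_def sgn_eq slit_nonzero)

lemma angle_near_bound:
  assumes "u \<in> slit u0" shows "\<bar>angle_near u0 u - Arg u0\<bar> < pi"
proof -
  have "Arg (u * cnj u0) \<noteq> pi"
    using assms by (auto simp: slit_def Arg_eq_pi complex_nonpos_Reals_iff)
  then show ?thesis
    using mpi_less_Arg[of "u * cnj u0"] Arg_le_pi[of "u * cnj u0"] by (auto simp: angle_near_def)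
qed

lemma
  assumes "0 < s" "u0 \<noteq> 0" "\<bar>t - Arg u0\<bar> < pi"
  shows rcis_in_slit: "rcis s t \<in> slit u0"
    and angle_near_rcis: "angle_near u0 (rcis s t) = t"
proof -
  have "cnj u0 = rcis (norm u0) (- Arg u0)"
    by (metis cis_cnj complex_cnj_complex_of_real complex_cnj_mult rcis_cmod_Arg rcis_def)
  then have e: "rcis s t * cnj u0 = rcis (s * norm u0) (t - Arg u0)"
    by (simp add: rcis_mult)
  have a: "Arg (rcis s t * cnj u0) = t - Arg u0"
    unfolding e by (rule Arg_rcis) (use assms in auto)
  then show "angle_near u0 (rcis s t) = t" by (simp add: angle_near_def)
  have "rcis s t * cnj u0 \<noteq> 0" using assms by (simp add: rcis_def)
  moreover have "Arg (rcis s t * cnj u0) \<noteq> pi" using a assms by auto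
  ultimately show "rcis s t \<in> slit u0"
    by (auto simp: slit_def Arg_eq_pi complex_nonpos_Reals_iff complex_eq_iff)
qed

section \<open>Angle coordinates on the torus\<close>

definition torus_slit :: "complex ^ 'i::finite \<Rightarrow> (complex ^ 'i) set" where
  "torus_slit w0 = {w. \<forall>i. w $ i \<in> slit (w0 $ i)}"

definition torus_angle :: "real ^ 'i::finite \<Rightarrow> complex ^ 'i \<Rightarrow> complex ^ 'i \<Rightarrow> real ^ 'i" where
  "torus_angle L w0 w = (\<chi> i. L $ i / (2 * pi) * angle_near (w0 $ i) (w $ i))"

definition torus_box :: "real ^ 'i::finite \<Rightarrow> complex ^ 'i \<Rightarrow> (real ^ 'i) set" where
  "torus_box L w0 = {\<theta>. \<forall>i. \<bar>2 * pi * \<theta> $ i / L $ i - Arg (w0 $ i)\<bar> < pi}"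

definition torus_point :: "real ^ 'i::finite \<Rightarrow> real ^ 'i \<Rightarrow> complex ^ 'i" where
  "torus_point L \<theta> = (\<chi> i. cis (2 * pi * \<theta> $ i / L $ i))"

lemma open_torus_slit: "open (torus_slit w0)"
proof -
  have "torus_slit w0 = (\<Inter>i. (\<lambda>w. w $ i) -` slit (w0 $ i))" by (auto simp: torus_slit_def)
  then show ?thesis
    by (auto intro!: open_INT open_vimage open_slit continuous_intros)
qed

lemma open_torus_box: "open (torus_box L w0)"
proof -
  have "torus_box L w0 = (\<Inter>i. {\<theta>. \<bar>2 * pi * \<theta> $ i / L $ i - Arg (w0 $ i)\<bar> < pi})"
    by (auto simp: torus_box_def)
  moreover have "open {\<theta> :: real ^ 'a. \<bar>2 * pi * \<theta> $ i / L $ i - Arg (w0 $ i)\<bar> < pi}" for i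
    unfolding divide_inverse by (intro open_Collect_less continuous_intros)
  ultimately show ?thesis by (auto intro!: open_INT)
qed

lemma torus_homeomorphism:
  assumes L: "\<And>i. 0 < L $ i" and w0: "\<And>i. norm (w0 $ i) = 1"
  shows "homeomorphism (torus_slit w0 \<inter> {w. \<forall>i. norm (w $ i) = 1}) (torus_box L w0)
           (torus_angle L w0) (torus_point L)"
proof (rule homeomorphismI)
  have w0n: "w0 $ i \<noteq> 0" for i using w0[of i] by auto
  have Ln: "L $ i \<noteq> 0" for i using L[of i] by simp
  have resc: "2 * pi * (L $ i / (2 * pi) * a) / L $ i = a" for i a
    using Ln by simp
  show "continuous_on (torus_slit w0 \<inter> {w. \<forall>i. norm (w $ i) = 1}) (torus_angle L w0)"
    unfolding torus_angle_def
    by (intro continuous_intros continuous_on_compose2[OF continuous_on_angle_near])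
      (auto simp: torus_slit_def)
  show "continuous_on (torus_box L w0) (torus_point L)"
    unfolding torus_point_def divide_inverse
    by (intro continuous_intros)
  show "torus_angle L w0 ` (torus_slit w0 \<inter> {w. \<forall>i. norm (w $ i) = 1}) \<subseteq> torus_box L w0"
    unfolding torus_angle_def torus_box_def torus_slit_def
    using angle_near_bound by (auto simp: resc simp del: times_divide_eq_left times_divide_eq_right)
  have eq: "cis t = rcis 1 t" for t by (simp add: rcis_def)
  show "torus_point L ` torus_box L w0 \<subseteq> torus_slit w0 \<inter> {w. \<forall>i. norm (w $ i) = 1}"
    by (auto simp: torus_point_def torus_box_def torus_slit_def) 
      (auto simp: eq w0n intro!: rcis_in_slit)
  show "torus_point L (torus_angle L w0 w) = w"
    if "w \<in> torus_slit w0 \<inter> {w. \<forall>i. norm (w $ i) = 1}" for w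
  proof -
    have "cis (angle_near (w0 $ i) (w $ i)) = w $ i" for i
      using that cis_angle_near[of "w $ i" "w0 $ i"] by (auto simp: torus_slit_def sgn_eq)
    then show ?thesis
      by (simp add: torus_point_def torus_angle_def vec_eq_iff resc 
          del: times_divide_eq_left times_divide_eq_right)
  qed
  show "torus_angle L w0 (torus_point L \<theta>) = \<theta>" if "\<theta> \<in> torus_box L w0" for \<theta>
  proof -
    have "angle_near (w0 $ i) (cis (2 * pi * \<theta> $ i / L $ i)) = 2 * pi * \<theta> $ i / L $ i" for i
      using angle_near_rcis[OF zero_less_one w0n, of "2 * pi * \<theta> $ i / L $ i" i] that
      by (auto simp: torus_box_def eq)
    then show ?thesis using Ln
      by (simp add: torus_point_def torus_angle_def vec_eq_iff)
  qed
qed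

lemma torus_angle_coord:
  fixes L :: "real ^ ('k::finite + 'k)"
  assumes L: "\<And>i. 0 < L $ i" and w0: "\<And>i. norm (w0 $ i) = 1"
    and w: "w \<in> torus_slit w0" "\<And>i. norm (w $ i) = 1"
  shows "is_torus_coord L w (torus_angle L w0 w)"
proof -
  have "torus_point L (torus_angle L w0 w) = w"
    using torus_homeomorphism[OF L w0] w by (auto simp: homeomorphism_def)
  then show ?thesis by (auto simp: is_torus_coord_def torus_point_def vec_eq_iff)
qed

text \<open>
  In the applications \<open>h\<close> only rearranges coordinates: it regroups \<open>((r, \<phi>), \<theta>)\<close> as \<open>(r, \<phi>, \<theta>)\<close> for polar
  charts, and combines the angles into complex numbers for holomorphic ones.
\<close>

lemma product_chart:
  fixes L :: "real ^ ('k::finite + 'k)"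
  assumes L: "\<And>i. 0 < L $ i" and w0: "\<And>i. norm (w0 $ i) = 1"
    and P: "homeomorphism U B P P'" "open U" "open B"
    and h: "homeomorphism UNIV UNIV h h'"
  shows "is_chart plane_times_torus
    (plane_times_torus \<inter> U \<times> torus_slit w0, \<lambda>p. h (P (fst p), torus_angle L w0 (snd p)))"
proof (rule is_chartI)
  let ?D = "plane_times_torus \<inter> U \<times> torus_slit w0"
  let ?C = "B \<times> torus_box L w0"
  note T = torus_homeomorphism[OF L w0, unfolded homeomorphism_def]
  note P' = P(1)[unfolded homeomorphism_def]
  note h' = h[unfolded homeomorphism_def]
  have D: "?D = U \<times> (torus_slit w0 \<inter> {w. \<forall>i. norm (w $ i) = 1})"
    by (auto simp: plane_times_torus_def)
  show "openin (top_of_set plane_times_torus) ?D"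
    by (intro openin_open_Int open_Times P open_torus_slit)
  have oC: "open ?C" by (intro open_Times P open_torus_box)
  have inv: "h ` ?C = h' -` ?C"
    using h' by (auto simp: image_iff) metis
  show "open (h ` ?C)"
    unfolding inv using h' oC by (intro open_vimage) auto
  show "homeomorphism ?D (h ` ?C) (\<lambda>p. h (P (fst p), torus_angle L w0 (snd p)))
     ((\<lambda>x. (P' (fst x), torus_point L (snd x))) \<circ> h')"
  proof (rule homeomorphismI)
    show "continuous_on ?D (\<lambda>p. h (P (fst p), torus_angle L w0 (snd p)))"
      unfolding D
      by (rule continuous_on_compose2[where g = h and t = UNIV])
        (use h' P' T in \<open>auto intro!: continuous_intros intro: continuous_on_compose2[where t = U and g = P]
          continuous_on_compose2[where t = "torus_slit w0 \<inter> {w. \<forall>i. norm (w $ i) = 1}" and g = "torus_angle L w0"]\<close>)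
    show "continuous_on (h ` ?C) ((\<lambda>x. (P' (fst x), torus_point L (snd x))) \<circ> h')"
    proof (rule continuous_on_compose)
      show "continuous_on (h ` ?C) h'" using h' continuous_on_subset by blast
      have "h' (h x) = x" for x using h' by blast
      then have "h' ` h ` ?C = ?C" by (simp add: image_image)
      then show "continuous_on (h' ` h ` ?C) (\<lambda>x. (P' (fst x), torus_point L (snd x)))"
        using P' T by (auto intro!: continuous_intros intro: continuous_on_compose2[where t = B and g = P']
          continuous_on_compose2[where t = "torus_box L w0" and g = "torus_point L"])
    qed
    show "(\<lambda>p. h (P (fst p), torus_angle L w0 (snd p))) ` ?D \<subseteq> h ` ?C"
      unfolding D using P' T by (auto intro!: imageI)
    show "((\<lambda>x. (P' (fst x), torus_point L (snd x))) \<circ> h') ` h ` ?C \<subseteq> ?D"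
      unfolding D using P' T h' by auto
  qed (use P' T h' in \<open>auto simp: D\<close>)
qed

section \<open>Functions that determine a point\<close>

text \<open>
  The coordinate \<open>q = sqrt (r - rp) * cis \<Phi>\<close>. Up to a positive smooth function of \<open>r\<close> it is the
  core coordinate \<open>x + \<i> y\<close>, and also the conjugate of the holomorphic coordinate.
\<close>

definition disc_coord :: "'k::finite point \<Rightarrow> complex" where
  "disc_coord p = sqrt (norm (fst p)) *\<^sub>R sgn (fst p)"

text \<open>
  Smoothness, for the smooth structure of the manifold, of a map into it, expressed without charts.
\<close>

definition smooth_map :: "real \<Rightarrow> 'a::real_normed_vector set \<Rightarrow> ('a \<Rightarrow> 'k::finite point) \<Rightarrow> bool" where
  "smooth_map rp S \<gamma> \<longleftrightarrow> smooth_on S (\<lambda>x. radius rp (\<gamma> x)) \<and> smooth_on S (\<lambda>x. disc_coord (\<gamma> x)) \<and>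
     (\<forall>i. smooth_on S (\<lambda>x. snd (\<gamma> x) $ i))"

lemma norm_disc_coord: "norm (disc_coord p) = sqrt (norm (fst p))"
  by (cases "fst p = 0") (auto simp: disc_coord_def norm_sgn)

lemma radius_ge: "rp \<le> radius rp p"
  by (simp add: radius_def)

lemma disc_coord_polar:
  assumes "is_polar_angle (fst p) \<Phi>"
  shows "disc_coord p = sqrt (radius rp p - rp) *\<^sub>R cis \<Phi>"
proof (cases "fst p = 0")
  case True
  then show ?thesis by (simp add: disc_coord_def radius_def)
next
  case False
  have "fst p = norm (fst p) *\<^sub>R cis \<Phi>"
    using assms by (simp add: is_polar_angle_def rcis_def scaleR_conv_of_real)
  then have "sgn (fst p) = sgn (norm (fst p)) *\<^sub>R sgn (cis \<Phi>)" by (metis sgn_scaleR)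
  then have "sgn (fst p) = cis \<Phi>" using False by (simp add: sgn_eq)
  then show ?thesis by (simp add: disc_coord_def radius_def)
qed

lemma continuous_on_disc_coord: "continuous_on UNIV (\<lambda>p. disc_coord p)"
proof -
  have "isCont (\<lambda>z. sqrt (norm z) *\<^sub>R sgn z) z" for z :: complex
  proof (cases "z = 0")
    case True
    have "((\<lambda>z :: complex. norm (sqrt (norm z) *\<^sub>R sgn z)) \<longlongrightarrow> 0) (at 0)"
    proof -
      have "((\<lambda>z :: complex. sqrt (norm z)) \<longlongrightarrow> sqrt (norm (0::complex))) (at 0)" by (intro tendsto_intros)
      moreover have "norm (sqrt (norm z) *\<^sub>R sgn z) = sqrt (norm z)" for z :: complex
        by (cases "z = 0") (auto simp: norm_sgn)
      ultimately show ?thesis by (simp only: norm_zero real_sqrt_zero)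
    qed
    then have "((\<lambda>z :: complex. sqrt (norm z) *\<^sub>R sgn z) \<longlongrightarrow> 0) (at 0)"
      by (rule tendsto_norm_zero_cancel)
    then show ?thesis using True by (simp add: isCont_def)
  next
    case False
    then show ?thesis by (intro continuous_intros isCont_sgn) auto
  qed
  then have "continuous_on UNIV (\<lambda>z :: complex. sqrt (norm z) *\<^sub>R sgn z)"
    by (simp add: continuous_on_eq_continuous_at)
  then show ?thesis unfolding disc_coord_def
    by (rule continuous_on_compose2) (auto intro!: continuous_intros)
qed

lemma continuous_on_radius: "continuous_on S (radius rp)"
  unfolding radius_def by (intro continuous_intros)

lemma smooth_torus_coord:
  fixes L :: "real ^ ('k::finite + 'k)" and \<gamma> :: "'a::real_normed_vector \<Rightarrow> 'k point"
  assumes L: "\<And>i. L $ i > 0" and S: "open S" and c: "continuous_on S \<theta>"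
    and t: "\<And>x. x \<in> S \<Longrightarrow> is_torus_coord L (snd (\<gamma> x)) (\<theta> x)"
    and s: "smooth_map rp S \<gamma>"
  shows "smooth_on S \<theta>"
proof -
  have "smooth_on S (\<lambda>x. \<theta> x $ i)" for i
  proof -
    let ?h = "\<lambda>x. 2 * pi / L $ i * \<theta> x $ i"
    have "smooth_on S (\<lambda>x. snd (\<gamma> x) $ i)" using s by (simp add: smooth_map_def)
    then have "smooth_on S (\<lambda>x. cis (?h x))"
      by (rule smooth_on_cong[OF S, rotated]) (use t in \<open>simp add: is_torus_coord_def\<close>)
    then have "smooth_on S ?h"
      by (intro smooth_on_circle_lift[OF S]) (intro continuous_intros c)
    from smooth_on_bounded_linear[OF bounded_linear_mult_right[of "L $ i / (2 * pi)"] S this]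
    show ?thesis using L[of i] by simp
  qed
  from smooth_on_vec[OF S, of "\<lambda>i x. \<theta> x $ i", OF this]
  show ?thesis by simp
qed

lemma smooth_torus_point:
  fixes L :: "real ^ ('k::finite + 'k)" and \<gamma> :: "'a::real_normed_vector \<Rightarrow> 'k point"
  assumes S: "open S" and t: "\<And>x. x \<in> S \<Longrightarrow> is_torus_coord L (snd (\<gamma> x)) (\<theta> x)"
    and s: "smooth_on S \<theta>"
  shows "smooth_on S (\<lambda>x. snd (\<gamma> x) $ i)"
proof -
  have "smooth_on S (\<lambda>x. cis (2 * pi / L $ i * \<theta> x $ i))"
    by (intro smooth_on_cis S smooth_on_bounded_linear[OF bounded_linear_mult_right S]
        smooth_on_bounded_linear[OF bounded_linear_vec_nth S] s)
  then show ?thesis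
    by (rule smooth_on_cong[OF S, rotated]) (use t in \<open>simp add: is_torus_coord_def\<close>)
qed

lemma smooth_on_Re: "open S \<Longrightarrow> smooth_on S f \<Longrightarrow> smooth_on S (\<lambda>x. Re (f x))"
  by (rule smooth_on_bounded_linear[OF bounded_linear_Re])

lemma smooth_on_Im: "open S \<Longrightarrow> smooth_on S f \<Longrightarrow> smooth_on S (\<lambda>x. Im (f x))"
  by (rule smooth_on_bounded_linear[OF bounded_linear_Im])

lemma smooth_on_cnj: "open S \<Longrightarrow> smooth_on S f \<Longrightarrow> smooth_on S (\<lambda>x. cnj (f x))"
  by (rule smooth_on_bounded_linear[OF bounded_linear_cnj])

lemma smooth_on_fst: "open S \<Longrightarrow> smooth_on S f \<Longrightarrow> smooth_on S (\<lambda>x. fst (f x))"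
  by (rule smooth_on_bounded_linear[OF bounded_linear_fst])

lemma smooth_on_snd: "open S \<Longrightarrow> smooth_on S f \<Longrightarrow> smooth_on S (\<lambda>x. snd (f x))"
  by (rule smooth_on_bounded_linear[OF bounded_linear_snd])

lemma smooth_on_Complex:
  assumes "open S" "smooth_on S f" "smooth_on S g"
  shows "smooth_on S (\<lambda>x. Complex (f x) (g x))"
proof -
  have "smooth_on S (\<lambda>x. of_real (f x) + \<i> * of_real (g x))"
    by (intro smooth_on_add smooth_on_bounded_linear[OF bounded_linear_mult_right]
       smooth_on_bounded_linear[OF bounded_linear_of_real] assms)
  then show ?thesis by (simp add: Complex_eq)
qed

text \<open>
  The signs make the components \<open>\<theta>\<^sup>j - \<i> \<theta>\<^sup>k\<^sup>+\<^sup>j\<close> holomorphic: \<open>J\<close> carries \<open>d\<theta>\<^sup>j\<close> to \<open>d\<theta>\<^sup>k\<^sup>+\<^sup>j\<close> and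
  \<open>d\<theta>\<^sup>k\<^sup>+\<^sup>j\<close> to \<open>- d\<theta>\<^sup>j\<close>.
\<close>

definition complexify :: "real ^ ('k::finite + 'k) \<Rightarrow> complex ^ 'k" where
  "complexify \<theta> = (\<chi> j. Complex (\<theta> $ Inl j) (- \<theta> $ Inr j))"

definition decomplexify :: "complex ^ 'k::finite \<Rightarrow> real ^ ('k + 'k)" where
  "decomplexify c = (\<chi> i. case i of Inl j \<Rightarrow> Re (c $ j) | Inr j \<Rightarrow> - Im (c $ j))"

lemma decomplexify_complexify [simp]: "decomplexify (complexify \<theta>) = \<theta>"
  by (auto simp: decomplexify_def complexify_def vec_eq_iff split: sum.splits)

lemma complexify_decomplexify [simp]: "complexify (decomplexify c) = c"
  by (auto simp: decomplexify_def complexify_def vec_eq_iff)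

lemma smooth_on_complexify:
  assumes "open S" "smooth_on S f" shows "smooth_on S (\<lambda>x. complexify (f x))"
  unfolding complexify_def
  by (intro smooth_on_vec smooth_on_Complex assms smooth_on_bounded_linear[OF bounded_linear_vec_nth]
      smooth_on_bounded_linear[OF bounded_linear_minus[OF bounded_linear_vec_nth]])

lemma smooth_on_decomplexify:
  assumes "open S" "smooth_on S f" shows "smooth_on S (\<lambda>x. decomplexify (f x))"
  unfolding decomplexify_def
proof (rule smooth_on_vec[OF assms(1)])
  fix i :: "'b + 'b"
  show "smooth_on S (\<lambda>x. case i of Inl j \<Rightarrow> Re (f x $ j) | Inr j \<Rightarrow> - Im (f x $ j))"
    by (cases i) (auto intro!: smooth_on_Re smooth_on_Im assms smooth_on_bounded_linear[OF bounded_linear_vec_nth]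
       smooth_on_bounded_linear[OF bounded_linear_minus[OF bounded_linear_ident]])
qed

section \<open>The three families of charts\<close>

text \<open>
  The data near the fixed locus of the circle action (the bolt). The last assumption says that
  \<open>K r = (r - rp) * E r\<close> satisfies \<open>K' / K = (4 \<pi> / \<beta>) / f\<close> for \<open>r > rp\<close>, that is,
  \<open>K = exp (4 \<pi> r\<^sub>* / \<beta>)\<close> for an
  antiderivative \<open>r\<^sub>*\<close> of \<open>1 / f\<close>. The functions live on \<open>r > b\<close> with \<open>b < rp\<close> so that \<open>rp\<close> is an
  interior point and smoothness there has its ordinary meaning.
\<close>

locale bolt =
  fixes f Q E :: "real \<Rightarrow> real" and b rp \<beta> :: real and L :: "real ^ ('k::finite + 'k)"
  assumes b: "b < rp" and \<beta>: "\<beta> > 0" and L: "\<And>i. L $ i > 0"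
    and Q: "smooth_on {b<..} Q" "\<And>r. r > b \<Longrightarrow> Q r > 0"
    and E: "smooth_on {b<..} E" "\<And>r. r > b \<Longrightarrow> E r > 0"
    and f: "\<And>r. r > b \<Longrightarrow> f r = (r - rp) * Q r"
    and K': "\<And>r. r > b \<Longrightarrow>
      ((\<lambda>r. (r - rp) * E r) has_real_derivative (4 * pi / \<beta>) * (E r / Q r)) (at r)"
begin

lemma radius_b: "b < radius rp p" for p :: "'k point"
  using b radius_ge[of rp p] by linarith

lemma factor_pos: "0 < Q (radius rp p)" "0 < E (radius rp p)" for p :: "'k point"
  using Q(2) E(2) radius_b by blast+

lemma sqrt_factor_nonzero: "sqrt (Q (radius rp p)) \<noteq> 0" "sqrt (E (radius rp p)) \<noteq> 0"
  for p :: "'k point"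
  using factor_pos[of p] by simp_all

lemma smooth_factor:
  fixes \<gamma> :: "'a::real_normed_vector \<Rightarrow> 'k point"
  assumes "open S" "smooth_on {b<..} g" "smooth_on S (\<lambda>x. radius rp (\<gamma> x))"
  shows "smooth_on S (\<lambda>x. g (radius rp (\<gamma> x)))"
  by (rule smooth_on_compose[OF assms(1,2,3)]) (simp add: radius_b image_subset_iff)

lemma smooth_times_linear:
  assumes "smooth_on {b<..} g" shows "smooth_on {b<..} (\<lambda>r. (r - rp) * g r)"
  by (intro smooth_on_mult smooth_on_diff smooth_on_id smooth_on_const assms) auto

lemma f_smooth: "smooth_on {b<..} f"
  by (rule smooth_on_cong[OF _ _ smooth_times_linear[OF Q(1)]]) (auto simp: f)

lemma polar_chart_at:
  assumes "\<kappa> \<in> polar_charts rp \<beta> L" "p \<in> cdom \<kappa>"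
  shows "fst (cmap \<kappa> p) = radius rp p" "rp < radius rp p"
    "disc_coord p = sqrt (radius rp p - rp) *\<^sub>R cis (2 * pi / \<beta> * fst (snd (cmap \<kappa> p)))"
    "is_torus_coord L (snd p) (snd (snd (cmap \<kappa> p)))"
proof -
  from assms obtain \<phi> \<theta> where "rp < radius rp p" "is_polar_angle (fst p) (2 * pi * \<phi> / \<beta>)"
    "is_torus_coord L (snd p) \<theta>" "cmap \<kappa> p = (radius rp p, \<phi>, \<theta>)"
    by (auto simp: polar_charts_def)
  then show "fst (cmap \<kappa> p) = radius rp p" "rp < radius rp p"
    "disc_coord p = sqrt (radius rp p - rp) *\<^sub>R cis (2 * pi / \<beta> * fst (snd (cmap \<kappa> p)))"
    "is_torus_coord L (snd p) (snd (snd (cmap \<kappa> p)))"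
    using disc_coord_polar[of p "2 * pi * \<phi> / \<beta>" rp] by auto
qed

lemma polar_chart_inverse_smooth:
  assumes "\<kappa> \<in> polar_charts rp \<beta> L"
  shows "smooth_map rp (cmap \<kappa> ` cdom \<kappa>) (cinv \<kappa>)"
proof -
  let ?S = "cmap \<kappa> ` cdom \<kappa>"
  have ch: "is_chart plane_times_torus \<kappa>" using assms by (simp add: polar_charts_def)
  have S: "open ?S" using is_chart_open_image[OF ch] .
  have at: "fst x = radius rp (cinv \<kappa> x)" "rp < radius rp (cinv \<kappa> x)"
    "disc_coord (cinv \<kappa> x) = sqrt (radius rp (cinv \<kappa> x) - rp) *\<^sub>R cis (2 * pi / \<beta> * fst (snd x))"
    "is_torus_coord L (snd (cinv \<kappa> x)) (snd (snd x))" if "x \<in> ?S" for x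
    using polar_chart_at[OF assms cinv_in_dom[OF that]] unfolding cmap_cinv[OF that] by auto
  have r: "smooth_on ?S (\<lambda>x. radius rp (cinv \<kappa> x))"
    by (rule smooth_on_cong[OF S at(1) smooth_on_fst[OF S smooth_on_id[OF S]]])
  have "smooth_on ?S (\<lambda>x. sqrt (radius rp (cinv \<kappa> x) - rp))"
    by (rule smooth_on_sqrt[OF S smooth_on_diff[OF S r smooth_on_const]]) (use at(2) in auto)
  moreover have "smooth_on ?S (\<lambda>x. cis (2 * pi / \<beta> * fst (snd x)))"
    by (intro S smooth_on_cis smooth_on_mult smooth_on_const smooth_on_fst smooth_on_snd smooth_on_id)
  ultimately have "smooth_on ?S
      (\<lambda>x. sqrt (radius rp (cinv \<kappa> x) - rp) *\<^sub>R cis (2 * pi / \<beta> * fst (snd x)))"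
    by (rule smooth_on_scaleR[OF S])
  then have d: "smooth_on ?S (\<lambda>x. disc_coord (cinv \<kappa> x))"
    by (rule smooth_on_cong[OF S at(3)[symmetric], rotated])
  have "smooth_on ?S (\<lambda>x. snd (cinv \<kappa> x) $ i)" for i
    by (rule smooth_torus_point[OF S at(4) smooth_on_snd[OF S smooth_on_snd[OF S smooth_on_id[OF S]]]])
  with r d show ?thesis by (simp add: smooth_map_def)
qed

text \<open>
  The branch of \<open>\<phi>\<close> is unknown; only its continuity and the point \<open>q / \<bar>q\<bar>\<close> on the circle are used.
\<close>

lemma polar_chart_smooth:
  assumes \<kappa>: "\<kappa> \<in> polar_charts rp \<beta> L" and S: "open S" and \<gamma>: "\<gamma> ` S \<subseteq> cdom \<kappa>"
    and c: "continuous_on S (\<lambda>x. cmap \<kappa> (\<gamma> x))" and s: "smooth_map rp S \<gamma>"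
  shows "smooth_on S (\<lambda>x. cmap \<kappa> (\<gamma> x))"
proof -
  have at: "fst (cmap \<kappa> (\<gamma> x)) = radius rp (\<gamma> x)" "rp < radius rp (\<gamma> x)"
    "disc_coord (\<gamma> x) = sqrt (radius rp (\<gamma> x) - rp) *\<^sub>R cis (2 * pi / \<beta> * fst (snd (cmap \<kappa> (\<gamma> x))))"
    "is_torus_coord L (snd (\<gamma> x)) (snd (snd (cmap \<kappa> (\<gamma> x))))"
    if "x \<in> S" for x
    using polar_chart_at[OF \<kappa>, of "\<gamma> x"] \<gamma> that by auto
  have r: "smooth_on S (\<lambda>x. radius rp (\<gamma> x))" and d: "smooth_on S (\<lambda>x. disc_coord (\<gamma> x))"
    using s by (auto simp: smooth_map_def)
  let ?h = "\<lambda>x. 2 * pi / \<beta> * fst (snd (cmap \<kappa> (\<gamma> x)))"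
  have "smooth_on S (\<lambda>x. sqrt (radius rp (\<gamma> x) - rp))"
    by (rule smooth_on_sqrt[OF S smooth_on_diff[OF S r smooth_on_const]]) (use at(2) in auto)
  then have "smooth_on S (\<lambda>x. inverse (sqrt (radius rp (\<gamma> x) - rp)) *\<^sub>R disc_coord (\<gamma> x))"
    by (rule smooth_on_scaleR[OF S smooth_on_inverse[OF S] d]) (use at(2) in force)
  moreover have "inverse (sqrt (radius rp (\<gamma> x) - rp)) *\<^sub>R disc_coord (\<gamma> x) = cis (?h x)"
    if "x \<in> S" for x
    unfolding at(3)[OF that] using at(2)[OF that] by simp
  ultimately have "smooth_on S (\<lambda>x. cis (?h x))"
    by (rule smooth_on_cong[OF S, rotated])
  then have "smooth_on S ?h"
    by (intro smooth_on_circle_lift[OF S]) (intro continuous_intros c)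
  from smooth_on_bounded_linear[OF bounded_linear_mult_right[of "\<beta> / (2 * pi)"] S this]
  have p: "smooth_on S (\<lambda>x. fst (snd (cmap \<kappa> (\<gamma> x))))" using \<beta> by simp
  have t: "smooth_on S (\<lambda>x. snd (snd (cmap \<kappa> (\<gamma> x))))"
    by (rule smooth_torus_coord[OF L S _ at(4) s]) (intro continuous_intros c)
  from smooth_on_Pair[OF S r smooth_on_Pair[OF S p t]] show ?thesis
    by (rule smooth_on_cong[OF S, rotated]) (simp add: prod_eq_iff at(1))
qed

lemma core_chart_at:
  assumes "\<kappa> \<in> core_charts f rp L" "p \<in> cdom \<kappa>"
  shows "deriv f (radius rp p) > 0"
    "Complex (fst (cmap \<kappa> p)) (fst (snd (cmap \<kappa> p))) = sqrt (Q (radius rp p)) *\<^sub>R disc_coord p"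
    "is_torus_coord L (snd p) (snd (snd (cmap \<kappa> p)))"
proof -
  from assms obtain \<Phi> \<theta> where *: "\<forall>s\<in>{rp..radius rp p}. 0 < deriv f s" "is_polar_angle (fst p) \<Phi>"
    "is_torus_coord L (snd p) \<theta>"
    "cmap \<kappa> p = (sqrt (f (radius rp p)) * cos \<Phi>, sqrt (f (radius rp p)) * sin \<Phi>, \<theta>)"
    by (auto simp: core_charts_def Let_def)
  have "sqrt (f (radius rp p)) = sqrt (radius rp p - rp) * sqrt (Q (radius rp p))"
    using f[OF radius_b, of p] by (simp add: real_sqrt_mult)
  with * show "Complex (fst (cmap \<kappa> p)) (fst (snd (cmap \<kappa> p))) = sqrt (Q (radius rp p)) *\<^sub>R disc_coord p"
    using disc_coord_polar[OF *(2), of rp] by (simp add: complex_eq_iff)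
  show "deriv f (radius rp p) > 0" "is_torus_coord L (snd p) (snd (snd (cmap \<kappa> p)))"
    using * radius_ge[of rp p] by auto
qed

lemma norm_disc_coord_sq: "(norm (disc_coord p))\<^sup>2 = radius rp p - rp"
  by (simp add: norm_disc_coord radius_def)

text \<open>
  The radius is recovered from \<open>x\<^sup>2 + y\<^sup>2 = f r\<close>, where \<open>f' r > 0\<close> on the domain of a core chart.
\<close>

lemma core_chart_inverse_smooth:
  assumes "\<kappa> \<in> core_charts f rp L"
  shows "smooth_map rp (cmap \<kappa> ` cdom \<kappa>) (cinv \<kappa>)"
proof -
  let ?S = "cmap \<kappa> ` cdom \<kappa>"
  have ch: "is_chart plane_times_torus \<kappa>" using assms by (simp add: core_charts_def)
  have S: "open ?S" using is_chart_open_image[OF ch] .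
  have at: "deriv f (radius rp (cinv \<kappa> x)) > 0"
    "Complex (fst x) (fst (snd x)) = sqrt (Q (radius rp (cinv \<kappa> x))) *\<^sub>R disc_coord (cinv \<kappa> x)"
    "is_torus_coord L (snd (cinv \<kappa> x)) (snd (snd x))" if "x \<in> ?S" for x
    using core_chart_at[OF assms cinv_in_dom[OF that]] unfolding cmap_cinv[OF that] by auto
  have fr: "(fst x)\<^sup>2 + (fst (snd x))\<^sup>2 = f (radius rp (cinv \<kappa> x))" if "x \<in> ?S" for x
  proof -
    have "(fst x)\<^sup>2 + (fst (snd x))\<^sup>2 = (norm (Complex (fst x) (fst (snd x))))\<^sup>2"
      by (simp add: cmod_power2)
    also have "\<dots> = Q (radius rp (cinv \<kappa> x)) * (radius rp (cinv \<kappa> x) - rp)"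
      unfolding at(2)[OF that] norm_scaleR power_mult_distrib norm_disc_coord_sq
      using Q(2)[OF radius_b, of "cinv \<kappa> x"] by simp
    finally show ?thesis using f[OF radius_b, of "cinv \<kappa> x"] by (simp add: mult.commute)
  qed
  have "smooth_on ?S (\<lambda>x. fst x * fst x + fst (snd x) * fst (snd x))"
    by (intro smooth_on_add smooth_on_mult smooth_on_fst smooth_on_snd smooth_on_id S)
  then have fr_smooth: "smooth_on ?S (\<lambda>x. f (radius rp (cinv \<kappa> x)))"
    by (rule smooth_on_cong[OF S, rotated]) (simp add: fr flip: power2_eq_square)
  have r: "smooth_on ?S (\<lambda>x. radius rp (cinv \<kappa> x))"
  proof (rule smooth_on_lift[OF _ f_smooth S _ _ _ fr_smooth])
    show "continuous_on ?S (\<lambda>x. radius rp (cinv \<kappa> x))"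
      by (rule continuous_on_compose2[OF continuous_on_radius is_chart_continuous_inv[OF ch] subset_refl])
    show "deriv f (radius rp (cinv \<kappa> x)) \<noteq> 0" if "x \<in> ?S" for x using at(1)[OF that] by simp
  qed (simp_all add: radius_b image_subset_iff)
  have "smooth_on ?S (\<lambda>x. inverse (sqrt (Q (radius rp (cinv \<kappa> x)))) *\<^sub>R Complex (fst x) (fst (snd x)))"
    by (rule smooth_on_scaleR[OF S smooth_on_inverse[OF S smooth_on_sqrt[OF S
          smooth_factor[OF S Q(1) r] factor_pos(1)] sqrt_factor_nonzero(1)]])
      (intro smooth_on_Complex smooth_on_fst smooth_on_snd smooth_on_id S)
  then have d: "smooth_on ?S (\<lambda>x. disc_coord (cinv \<kappa> x))"
    by (rule smooth_on_cong[OF S, rotated])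
      (use sqrt_factor_nonzero in \<open>simp add: at(2)\<close>)
  have "smooth_on ?S (\<lambda>x. snd (cinv \<kappa> x) $ i)" for i
    by (rule smooth_torus_point[OF S at(3) smooth_on_snd[OF S smooth_on_snd[OF S smooth_on_id[OF S]]]])
  with r d show ?thesis by (simp add: smooth_map_def)
qed

lemma core_chart_smooth:
  assumes \<kappa>: "\<kappa> \<in> core_charts f rp L" and S: "open S" and \<gamma>: "\<gamma> ` S \<subseteq> cdom \<kappa>"
    and c: "continuous_on S (\<lambda>x. cmap \<kappa> (\<gamma> x))" and s: "smooth_map rp S \<gamma>"
  shows "smooth_on S (\<lambda>x. cmap \<kappa> (\<gamma> x))"
proof -
  have at: "Complex (fst (cmap \<kappa> (\<gamma> x))) (fst (snd (cmap \<kappa> (\<gamma> x)))) =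
       sqrt (Q (radius rp (\<gamma> x))) *\<^sub>R disc_coord (\<gamma> x)"
    "is_torus_coord L (snd (\<gamma> x)) (snd (snd (cmap \<kappa> (\<gamma> x))))" if "x \<in> S" for x
    using core_chart_at[OF \<kappa>, of "\<gamma> x"] \<gamma> that by auto
  have r: "smooth_on S (\<lambda>x. radius rp (\<gamma> x))" and d: "smooth_on S (\<lambda>x. disc_coord (\<gamma> x))"
    using s by (auto simp: smooth_map_def)
  let ?w = "\<lambda>x. sqrt (Q (radius rp (\<gamma> x))) *\<^sub>R disc_coord (\<gamma> x)"
  have w: "smooth_on S ?w"
    by (rule smooth_on_scaleR[OF S smooth_on_sqrt[OF S smooth_factor[OF S Q(1) r] factor_pos(1)] d])
  have t: "smooth_on S (\<lambda>x. snd (snd (cmap \<kappa> (\<gamma> x))))"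
    by (rule smooth_torus_coord[OF L S _ at(2) s]) (intro continuous_intros c)
  from smooth_on_Pair[OF S smooth_on_Re[OF S w] smooth_on_Pair[OF S smooth_on_Im[OF S w] t]]
  show ?thesis
    by (rule smooth_on_cong[OF S, rotated]) (simp add: prod_eq_iff flip: at(1))
qed

text \<open>
  Charts \<open>(W, (\<theta>\<^sup>j - \<i> \<theta>\<^sup>k\<^sup>+\<^sup>j)\<^sub>j)\<close>, for all branches of the angles.
\<close>

definition holo_charts :: "('k point, complex \<times> (complex ^ 'k)) chart set" where
  "holo_charts = {\<zeta>. is_chart plane_times_torus \<zeta> \<and>
     (\<forall>p\<in>cdom \<zeta>. fst (cmap \<zeta> p) = sqrt (E (radius rp p)) *\<^sub>R cnj (disc_coord p) \<and>
        is_torus_coord L (snd p) (decomplexify (snd (cmap \<zeta> p))))}"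

lemma holo_chart_at:
  assumes "\<zeta> \<in> holo_charts" "p \<in> cdom \<zeta>"
  shows "fst (cmap \<zeta> p) = sqrt (E (radius rp p)) *\<^sub>R cnj (disc_coord p)"
    "is_torus_coord L (snd p) (decomplexify (snd (cmap \<zeta> p)))"
  using assms by (auto simp: holo_charts_def)

lemma deriv_K: "r > b \<Longrightarrow> deriv (\<lambda>r. (r - rp) * E r) r = (4 * pi / \<beta>) * (E r / Q r)"
  using K' by (rule DERIV_imp_deriv)

lemma deriv_K_pos: "r > b \<Longrightarrow> 0 < (4 * pi / \<beta>) * (E r / Q r)"
  using \<beta> Q(2) E(2) by simp

text \<open>
  The radius is recovered from \<open>\<bar>W\<bar>\<^sup>2 = K r\<close>, where \<open>K' r > 0\<close> for all \<open>r > b\<close>.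
\<close>

lemma holo_chart_inverse_smooth:
  assumes "\<zeta> \<in> holo_charts"
  shows "smooth_map rp (cmap \<zeta> ` cdom \<zeta>) (cinv \<zeta>)"
proof -
  let ?S = "cmap \<zeta> ` cdom \<zeta>"
  have ch: "is_chart plane_times_torus \<zeta>" using assms by (simp add: holo_charts_def)
  have S: "open ?S" using is_chart_open_image[OF ch] .
  have at: "fst x = sqrt (E (radius rp (cinv \<zeta> x))) *\<^sub>R cnj (disc_coord (cinv \<zeta> x))"
    "is_torus_coord L (snd (cinv \<zeta> x)) (decomplexify (snd x))" if "x \<in> ?S" for x
    using holo_chart_at[OF assms cinv_in_dom[OF that]] unfolding cmap_cinv[OF that] by auto
  have Kr: "fst x \<bullet> fst x = (radius rp (cinv \<zeta> x) - rp) * E (radius rp (cinv \<zeta> x))" if "x \<in> ?S" for x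
  proof -
    have "fst x \<bullet> fst x = (norm (fst x))\<^sup>2" by (simp add: power2_norm_eq_inner)
    also have "\<dots> = E (radius rp (cinv \<zeta> x)) * (radius rp (cinv \<zeta> x) - rp)"
      unfolding at(1)[OF that] norm_scaleR power_mult_distrib complex_mod_cnj norm_disc_coord_sq
      using E(2)[OF radius_b, of "cinv \<zeta> x"] by simp
    finally show ?thesis by (simp add: mult.commute)
  qed
  have "smooth_on ?S (\<lambda>x. fst x \<bullet> fst x)"
    by (intro smooth_on_bilinear[OF bounded_bilinear_inner] smooth_on_fst smooth_on_id S)
  then have Kr_smooth: "smooth_on ?S (\<lambda>x. (radius rp (cinv \<zeta> x) - rp) * E (radius rp (cinv \<zeta> x)))"
    by (rule smooth_on_cong[OF S, rotated]) (simp add: Kr)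
  have r: "smooth_on ?S (\<lambda>x. radius rp (cinv \<zeta> x))"
  proof (rule smooth_on_lift[OF _ smooth_times_linear[OF E(1)] S _ _ _ Kr_smooth])
    show "continuous_on ?S (\<lambda>x. radius rp (cinv \<zeta> x))"
      by (rule continuous_on_compose2[OF continuous_on_radius is_chart_continuous_inv[OF ch] subset_refl])
    show "deriv (\<lambda>r. (r - rp) * E r) (radius rp (cinv \<zeta> x)) \<noteq> 0" if "x \<in> ?S" for x
      unfolding deriv_K[OF radius_b]
      by (rule less_imp_neq[THEN not_sym, OF deriv_K_pos[OF radius_b]])
  qed (simp_all add: radius_b image_subset_iff)
  have "smooth_on ?S (\<lambda>x. inverse (sqrt (E (radius rp (cinv \<zeta> x)))) *\<^sub>R cnj (fst x))"
    by (rule smooth_on_scaleR[OF S smooth_on_inverse[OF S smooth_on_sqrt[OF S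
          smooth_factor[OF S E(1) r] factor_pos(2)] sqrt_factor_nonzero(2)]])
      (intro smooth_on_cnj smooth_on_fst smooth_on_id S)
  then have d: "smooth_on ?S (\<lambda>x. disc_coord (cinv \<zeta> x))"
    by (rule smooth_on_cong[OF S, rotated])
      (use sqrt_factor_nonzero in \<open>simp add: at(1)\<close>)
  have "smooth_on ?S (\<lambda>x. snd (cinv \<zeta> x) $ i)" for i
    by (rule smooth_torus_point[OF S at(2) smooth_on_decomplexify[OF S smooth_on_snd[OF S smooth_on_id[OF S]]]])
  with r d show ?thesis by (simp add: smooth_map_def)
qed

lemma holo_chart_smooth:
  assumes \<zeta>: "\<zeta> \<in> holo_charts" and S: "open S" and \<gamma>: "\<gamma> ` S \<subseteq> cdom \<zeta>"
    and c: "continuous_on S (\<lambda>x. cmap \<zeta> (\<gamma> x))" and s: "smooth_map rp S \<gamma>"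
  shows "smooth_on S (\<lambda>x. cmap \<zeta> (\<gamma> x))"
proof -
  have at: "fst (cmap \<zeta> (\<gamma> x)) = sqrt (E (radius rp (\<gamma> x))) *\<^sub>R cnj (disc_coord (\<gamma> x))"
    "is_torus_coord L (snd (\<gamma> x)) (decomplexify (snd (cmap \<zeta> (\<gamma> x))))" if "x \<in> S" for x
    using holo_chart_at[OF \<zeta>, of "\<gamma> x"] \<gamma> that by auto
  have r: "smooth_on S (\<lambda>x. radius rp (\<gamma> x))" and d: "smooth_on S (\<lambda>x. disc_coord (\<gamma> x))"
    using s by (auto simp: smooth_map_def)
  have w: "smooth_on S (\<lambda>x. sqrt (E (radius rp (\<gamma> x))) *\<^sub>R cnj (disc_coord (\<gamma> x)))"
    by (rule smooth_on_scaleR[OF S smooth_on_sqrt[OF S smooth_factor[OF S E(1) r] factor_pos(2)]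
          smooth_on_cnj[OF S d]])
  have "continuous_on UNIV (decomplexify :: complex ^ 'k \<Rightarrow> _)"
    using smooth_on_imp_continuous_on[OF smooth_on_decomplexify[OF open_UNIV smooth_on_id[OF open_UNIV]]] .
  then have "continuous_on S (\<lambda>x. decomplexify (snd (cmap \<zeta> (\<gamma> x))))"
    by (rule continuous_on_compose2) (auto intro!: continuous_intros c)
  then have "smooth_on S (\<lambda>x. decomplexify (snd (cmap \<zeta> (\<gamma> x))))"
    by (rule smooth_torus_coord[OF L S _ at(2) s])
  from smooth_on_Pair[OF S w smooth_on_complexify[OF S this]] show ?thesis
    by (rule smooth_on_cong[OF S, rotated]) (simp add: prod_eq_iff at(1))
qed

end

lemma smooth_map_subset: "smooth_map rp S \<gamma> \<Longrightarrow> T \<subseteq> S \<Longrightarrow> smooth_map rp T \<gamma>"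
  by (auto simp: smooth_map_def intro: smooth_on_subset)

text \<open>
  As \<open>cis\<close> has nowhere vanishing derivative, a branch of the angle inherits its differential from the
  map into the circle that it lifts.
\<close>

lemma derivative_eq_of_cis_eq:
  fixes h h' :: "'a::real_normed_vector \<Rightarrow> real"
  assumes "(h has_derivative D) (at x)" "(h' has_derivative D') (at x)" "open S" "x \<in> S"
    and "\<And>y. y \<in> S \<Longrightarrow> cis (c * h y) = cis (c * h' y)" "c \<noteq> 0"
  shows "D = D'"
proof -
  have 1: "((\<lambda>y. cis (c * h y)) has_derivative (\<lambda>v. (c * D v) *\<^sub>R (\<i> * cis (c * h x)))) (at x)"
    by (intro has_derivative_cis has_derivative_mult_right assms)
  have 2: "((\<lambda>y. cis (c * h' y)) has_derivative (\<lambda>v. (c * D' v) *\<^sub>R (\<i> * cis (c * h' x)))) (at x)"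
    by (intro has_derivative_cis has_derivative_mult_right assms)
  have 3: "((\<lambda>y. cis (c * h' y)) has_derivative (\<lambda>v. (c * D v) *\<^sub>R (\<i> * cis (c * h x)))) (at x)"
    by (rule has_derivative_transform_within_open[OF 1 assms(3,4)]) (rule assms(5))
  have "(c * D v) *\<^sub>R (\<i> * cis (c * h x)) = (c * D' v) *\<^sub>R (\<i> * cis (c * h x))" for v
    using fun_cong[OF has_derivative_unique[OF 3 2], of v] assms(5)[OF assms(4)] by simp
  then show ?thesis using assms(6) by (auto simp: fun_eq_iff)
qed

lemma bounded_linear_decomplexify: "bounded_linear decomplexify"
  unfolding linear_conv_bounded_linear[symmetric]
  by (rule linearI) (auto simp: decomplexify_def vec_eq_iff split: sum.splits)

context bolt
begin

abbreviation "A \<equiv> the_atlas f rp \<beta> L"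

lemma atlas_chart: "\<kappa> \<in> A \<Longrightarrow> is_chart plane_times_torus \<kappa>"
  by (auto simp: the_atlas_def polar_charts_def core_charts_def)

lemma atlas_inverse_smooth: "\<kappa> \<in> A \<Longrightarrow> smooth_map rp (cmap \<kappa> ` cdom \<kappa>) (cinv \<kappa>)"
  unfolding the_atlas_def using polar_chart_inverse_smooth core_chart_inverse_smooth by blast

lemma atlas_smooth:
  assumes "\<kappa> \<in> A" "open S" "\<gamma> ` S \<subseteq> cdom \<kappa>" "continuous_on S (\<lambda>x. cmap \<kappa> (\<gamma> x))" "smooth_map rp S \<gamma>"
  shows "smooth_on S (\<lambda>x. cmap \<kappa> (\<gamma> x))"
  using assms(1) polar_chart_smooth[OF _ assms(2-)] core_chart_smooth[OF _ assms(2-)]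
  by (auto simp: the_atlas_def)

text \<open>
  The functions \<open>r\<close>, \<open>q\<close> and the torus point mediate between any two charts, so that it is enough to
  treat each family of charts once in each direction.
\<close>

lemma transition_smooth:
  fixes \<kappa> :: "('k point, 'e::real_normed_vector) chart" and \<kappa>' :: "('k point, 'f::real_normed_vector) chart"
  assumes c: "is_chart M \<kappa>" "is_chart M \<kappa>'" and s: "smooth_map rp (cmap \<kappa> ` cdom \<kappa>) (cinv \<kappa>)"
    and H: "\<And>(S :: 'e set) \<gamma>. open S \<Longrightarrow> \<gamma> ` S \<subseteq> cdom \<kappa>' \<Longrightarrow> continuous_on S (\<lambda>x. cmap \<kappa>' (\<gamma> x)) \<Longrightarrow>
              smooth_map rp S \<gamma> \<Longrightarrow> smooth_on S (\<lambda>x. cmap \<kappa>' (\<gamma> x))"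
  shows "smooth_on (cmap \<kappa> ` (cdom \<kappa> \<inter> cdom \<kappa>')) (transition \<kappa> \<kappa>')"
proof -
  let ?S = "cmap \<kappa> ` (cdom \<kappa> \<inter> cdom \<kappa>')"
  have sub: "?S \<subseteq> cmap \<kappa> ` cdom \<kappa>" by blast
  have im: "cinv \<kappa> ` ?S \<subseteq> cdom \<kappa>'" using is_chart_inv[OF c(1)] by auto
  have "continuous_on ?S (\<lambda>x. cmap \<kappa>' (cinv \<kappa> x))"
    by (rule continuous_on_compose2[OF is_chart_continuous[OF c(2)]
          continuous_on_subset[OF is_chart_continuous_inv[OF c(1)] sub] im])
  from H[OF open_overlap[OF c] im this smooth_map_subset[OF s sub]]
  show ?thesis by (simp add: transition_def o_def)
qed

lemma atlas_transition_smooth: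
  assumes "\<kappa> \<in> A" "\<kappa>' \<in> A"
  shows "smooth_on (cmap \<kappa> ` (cdom \<kappa> \<inter> cdom \<kappa>')) (transition \<kappa> \<kappa>')"
  by (rule transition_smooth[OF assms[THEN atlas_chart] atlas_inverse_smooth[OF assms(1)]
        atlas_smooth[OF assms(2)]])

lemma holo_chart: "\<zeta> \<in> holo_charts \<Longrightarrow> is_chart plane_times_torus \<zeta>"
  by (simp add: holo_charts_def)

lemma holo_transition_smooth:
  assumes "\<kappa> \<in> A" "\<zeta> \<in> holo_charts"
  shows "smooth_on (cmap \<kappa> ` (cdom \<kappa> \<inter> cdom \<zeta>)) (transition \<kappa> \<zeta>)"
  by (rule transition_smooth[OF atlas_chart[OF assms(1)] holo_chart[OF assms(2)]
        atlas_inverse_smooth[OF assms(1)] holo_chart_smooth[OF assms(2)]])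

lemma holo_smoothly_compatible:
  assumes "\<kappa> \<in> A" "\<zeta> \<in> holo_charts"
  shows "smoothly_compatible \<kappa> \<zeta>"
proof -
  have "smooth_on (cmap \<zeta> ` (cdom \<zeta> \<inter> cdom \<kappa>)) (transition \<zeta> \<kappa>)"
    by (rule transition_smooth[OF holo_chart[OF assms(2)] atlas_chart[OF assms(1)]
        holo_chart_inverse_smooth[OF assms(2)] atlas_smooth[OF assms(1)]])
  then show ?thesis
    using holo_transition_smooth[OF assms] by (simp add: smoothly_compatible_def Int_commute)
qed

section \<open>Existence of polar and holomorphic charts\<close>

lemma polar_chart_exists:
  fixes p :: "'k point"
  assumes p: "p \<in> plane_times_torus" "rp < radius rp p"
  obtains \<kappa> where "\<kappa> \<in> polar_charts rp \<beta> L" "p \<in> cdom \<kappa>"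
proof -
  let ?z0 = "fst p" and ?w0 = "snd p"
  have z0: "?z0 \<noteq> 0" using p(2) by (auto simp: radius_def)
  have w0: "norm (?w0 $ i) = 1" for i using p(1) by (auto simp: plane_times_torus_def)
  have w0n: "?w0 $ i \<noteq> 0" for i using w0[of i] by auto
  let ?B = "{rp<..} \<times> {t. \<bar>2 * pi * t / \<beta> - Arg ?z0\<bar> < pi}"
  let ?P = "\<lambda>z. (rp + norm z, \<beta> / (2 * pi) * angle_near ?z0 z)"
  let ?P' = "\<lambda>x. rcis (fst x - rp) (2 * pi * snd x / \<beta>)"
  have resc: "2 * pi * (\<beta> / (2 * pi) * a) / \<beta> = a" for a using \<beta> by simp
  have hom: "homeomorphism (slit ?z0) ?B ?P ?P'"
  proof (rule homeomorphismI)
    show "continuous_on (slit ?z0) ?P"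
      by (intro continuous_intros continuous_on_angle_near)
    show "continuous_on ?B ?P'"
      unfolding rcis_def divide_inverse by (intro continuous_intros)
    show "?P ` slit ?z0 \<subseteq> ?B"
      using slit_nonzero angle_near_bound by (fastforce simp: resc simp del: times_divide_eq_left times_divide_eq_right)
    show "?P' ` ?B \<subseteq> slit ?z0"
      using rcis_in_slit[OF _ z0] by auto
    show "?P' (?P z) = z" if "z \<in> slit ?z0" for z
      using rcis_angle_near[OF that] by (simp add: resc del: times_divide_eq_left times_divide_eq_right)
    show "?P (?P' x) = x" if "x \<in> ?B" for x
      using that angle_near_rcis[OF _ z0, of "fst x - rp" "2 * pi * snd x / \<beta>"] \<beta> by (auto simp: prod_eq_iff)
  qed
  have oB: "open ?B"
    unfolding divide_inverse by (intro open_Times open_Collect_less continuous_intros open_greaterThan)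
  let ?h = "\<lambda>x :: (real \<times> real) \<times> (real ^ ('k + 'k)). (fst (fst x), snd (fst x), snd x)"
  have h: "homeomorphism UNIV UNIV ?h (\<lambda>y. ((fst y, fst (snd y)), snd (snd y)))"
    by (rule homeomorphismI) (auto intro!: continuous_intros)
  let ?\<kappa> = "(plane_times_torus \<inter> slit ?z0 \<times> torus_slit ?w0,
     \<lambda>q :: 'k point. ?h (?P (fst q), torus_angle L ?w0 (snd q)))"
  have chart: "is_chart plane_times_torus ?\<kappa>"
    by (rule product_chart[OF L w0 hom open_slit oB h])
  have "?\<kappa> \<in> polar_charts rp \<beta> L"
    unfolding polar_charts_def
  proof (intro CollectI conjI ballI chart)
    fix q :: "'k point" assume "q \<in> cdom ?\<kappa>"
    then have q: "fst q \<in> slit ?z0" "snd q \<in> torus_slit ?w0" "norm (snd q $ i) = 1" for i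
      by (auto simp: plane_times_torus_def)
    show "rp < radius rp q" using slit_nonzero[OF q(1)] by (simp add: radius_def)
    show "\<exists>\<phi> \<theta>. is_polar_angle (fst q) (2 * pi * \<phi> / \<beta>) \<and> is_torus_coord L (snd q) \<theta> \<and>
        cmap ?\<kappa> q = (radius rp q, \<phi>, \<theta>)"
    proof (intro exI conjI)
      show "is_polar_angle (fst q) (2 * pi * (\<beta> / (2 * pi) * angle_near ?z0 (fst q)) / \<beta>)"
        unfolding resc is_polar_angle_def by (rule rcis_angle_near[OF q(1)])
      show "is_torus_coord L (snd q) (torus_angle L ?w0 (snd q))"
        by (rule torus_angle_coord[OF L w0 q(2,3)])
    qed (simp add: radius_def)
  qed
  moreover have "p \<in> cdom ?\<kappa>"
    using p(1) self_in_slit[OF z0] self_in_slit[OF w0n]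
    by (auto simp: torus_slit_def mem_Times_iff)
  ultimately show ?thesis by (rule that)
qed

text \<open>
  The coordinate \<open>W\<close> is injective on the whole plane since \<open>\<bar>W\<bar>\<^sup>2 = K r\<close> is strictly increasing in
  \<open>r\<close>; invariance of domain makes it a homeomorphism onto an open set.
\<close>

lemma holo_chart_exists:
  fixes p :: "'k point"
  assumes p: "p \<in> plane_times_torus"
  obtains \<zeta> where "\<zeta> \<in> holo_charts" "p \<in> cdom \<zeta>"
proof -
  let ?w0 = "snd p"
  have w0: "norm (?w0 $ i) = 1" for i using p(1) by (auto simp: plane_times_torus_def)
  have w0n: "?w0 $ i \<noteq> 0" for i using w0[of i] by auto
  \<comment> \<open>\<open>radius\<close> and \<open>disc_coord\<close> see only the first component, so the torus point is arbitrary\<close>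
  let ?P = "\<lambda>z. sqrt (E (radius rp (z, ?w0))) *\<^sub>R cnj (disc_coord (z, ?w0))"
  have cP: "continuous_on UNIV ?P"
  proof -
    have "continuous_on UNIV (\<lambda>z. E (radius rp (z, ?w0)))"
      by (rule continuous_on_compose2[OF smooth_on_imp_continuous_on[OF E(1)]
            continuous_on_compose2[OF continuous_on_radius[of UNIV rp]]])
        (use radius_b in \<open>auto intro!: continuous_intros\<close>)
    moreover have "continuous_on UNIV (\<lambda>z. disc_coord (z, ?w0))"
      by (rule continuous_on_compose2[OF continuous_on_disc_coord]) (auto intro!: continuous_intros)
    ultimately show ?thesis by (intro continuous_intros)
  qed
  have normP: "(norm (?P z))\<^sup>2 = (radius rp (z, ?w0) - rp) * E (radius rp (z, ?w0))" for z
    using factor_pos(2)[of "(z, ?w0)"]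
    by (simp add: power_mult_distrib norm_disc_coord_sq abs_of_pos)
  have mono: "(r - rp) * E r < (s - rp) * E s" if "b < r" "r < s" for r s
    by (rule DERIV_pos_imp_increasing[OF that(2)])
      (use that K' deriv_K_pos in \<open>meson order_less_le_trans\<close>)
  have "inj ?P"
  proof (rule injI)
    fix z z' assume eq: "?P z = ?P z'"
    let ?r = "radius rp (z, ?w0)" and ?r' = "radius rp (z', ?w0)"
    have "(?r - rp) * E ?r = (?r' - rp) * E ?r'" using normP[of z] normP[of z'] eq by simp
    then have r: "?r = ?r'"
      using mono[OF radius_b, of "(z, ?w0)" ?r'] mono[OF radius_b, of "(z', ?w0)" ?r]
      by (metis less_irrefl linorder_neqE)
    then have n: "norm z = norm z'" by (simp add: radius_def)
    have "disc_coord (z, ?w0) = disc_coord (z', ?w0)"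
      using eq sqrt_factor_nonzero(2)[of "(z', ?w0)"] unfolding r by simp
    then show "z = z'"
      using n by (cases "z = 0") (auto simp: disc_coord_def sgn_eq)
  qed
  then obtain P' where P': "homeomorphism UNIV (range ?P) ?P P'"
    using invariance_of_domain_homeomorphism[OF open_UNIV cP] by auto
  have oB: "open (range ?P)" by (rule invariance_of_domain[OF cP open_UNIV \<open>inj ?P\<close>])
  have c1: "continuous_on UNIV (complexify :: real ^ ('k + 'k) \<Rightarrow> _)"
    and c2: "continuous_on UNIV (decomplexify :: complex ^ 'k \<Rightarrow> _)"
    using smooth_on_imp_continuous_on[OF smooth_on_complexify[OF open_UNIV smooth_on_id[OF open_UNIV]]]
      smooth_on_imp_continuous_on[OF smooth_on_decomplexify[OF open_UNIV smooth_on_id[OF open_UNIV]]] .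
  let ?h = "\<lambda>x :: complex \<times> (real ^ ('k + 'k)). (fst x, complexify (snd x))"
  have h: "homeomorphism UNIV UNIV ?h (\<lambda>y. (fst y, decomplexify (snd y)))"
    by (rule homeomorphismI)
      (auto intro!: continuous_intros continuous_on_compose2[OF c1] continuous_on_compose2[OF c2])
  let ?\<zeta> = "(plane_times_torus \<inter> UNIV \<times> torus_slit ?w0,
     \<lambda>q :: 'k point. ?h (?P (fst q), torus_angle L ?w0 (snd q)))"
  have chart: "is_chart plane_times_torus ?\<zeta>"
    by (rule product_chart[OF L w0 P' open_UNIV oB h])
  have "?\<zeta> \<in> holo_charts"
    unfolding holo_charts_def
  proof (intro CollectI conjI ballI chart)
    fix q :: "'k point" assume "q \<in> cdom ?\<zeta>"
    then have q: "snd q \<in> torus_slit ?w0" "norm (snd q $ i) = 1" for i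
      by (auto simp: plane_times_torus_def)
    show "fst (cmap ?\<zeta> q) = sqrt (E (radius rp q)) *\<^sub>R cnj (disc_coord q)"
      by (simp add: radius_def disc_coord_def)
    show "is_torus_coord L (snd q) (decomplexify (snd (cmap ?\<zeta> q)))"
      using torus_angle_coord[OF L w0 q(1,2)] by simp
  qed
  moreover have "p \<in> cdom ?\<zeta>"
    using p(1) self_in_slit[OF w0n] by (auto simp: torus_slit_def mem_Times_iff)
  ultimately show ?thesis by (rule that)
qed

section \<open>The identities in polar charts\<close>

text \<open>
  The given values on \<open>dr / f\<close> and \<open>d\<theta>\<^sup>j\<close> determine \<open>J\<close>: the two remaining values follow from
  \<open>J\<^sup>2 = - 1\<close>.
\<close>

lemma J_polar:
  assumes J: "almost_complex_structure A J" "is_structure_J f rp \<beta> L J"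
    and \<kappa>: "\<kappa> \<in> polar_charts rp \<beta> L" "p \<in> cdom \<kappa>"
  shows "dr (J \<kappa> p v) = f (radius rp p) * dphi v"
    "dphi (J \<kappa> p v) = - dr v / f (radius rp p)"
    "dtheta (Inl j) (J \<kappa> p v) = dtheta (Inr j) v"
    "dtheta (Inr j) (J \<kappa> p v) = - dtheta (Inl j) v"
proof -
  have pos: "f (radius rp p) > 0"
    using f[OF radius_b, of p] factor_pos(1)[of p] polar_chart_at(2)[OF \<kappa>] by simp
  have "\<kappa> \<in> A" using \<kappa>(1) by (simp add: the_atlas_def)
  then have JJ: "J \<kappa> p (J \<kappa> p v) = - v"
    using J(1) \<kappa>(2) unfolding almost_complex_structure_def by blast
  have form: "act_on_form (J \<kappa> p) (\<lambda>v. 1 / f (radius rp p) * dr v) = dphi"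
    "act_on_form (J \<kappa> p) (dtheta (Inl j)) = dtheta (Inr j)"
    using J(2) \<kappa> by (auto simp: is_structure_J_def)
  have 1: "1 / f (radius rp p) * dr (J \<kappa> p u) = dphi u" for u
    using fun_cong[OF form(1), of u] by (simp add: act_on_form_def)
  have 2: "dtheta (Inl j) (J \<kappa> p u) = dtheta (Inr j) u" for u
    using fun_cong[OF form(2), of u] by (simp add: act_on_form_def)
  show "dr (J \<kappa> p v) = f (radius rp p) * dphi v" using 1[of v] pos by (simp add: field_simps)
  show "dphi (J \<kappa> p v) = - dr v / f (radius rp p)" using 1[of "J \<kappa> p v"] JJ by (simp add: dr_def)
  show "dtheta (Inl j) (J \<kappa> p v) = dtheta (Inr j) v" by (rule 2)
  show "dtheta (Inr j) (J \<kappa> p v) = - dtheta (Inl j) v"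
    using 2[of "J \<kappa> p v"] JJ by (simp add: dtheta_def)
qed

text \<open>
  In each of the coframes \<open>(dr / sqrt f, sqrt f d\<phi>)\<close> and \<open>(r d\<theta>\<^sup>j, r d\<theta>\<^sup>k\<^sup>+\<^sup>j)\<close>, which are orthonormal
  for \<open>g\<close>, the structure \<open>J\<close> is a rotation by a right angle.
\<close>

lemma metric_compatible_polar:
  assumes J: "almost_complex_structure A J" "is_structure_J f rp \<beta> L J"
    and g: "is_metric_g f rp \<beta> L g"
    and \<kappa>: "\<kappa> \<in> polar_charts rp \<beta> L" "p \<in> cdom \<kappa>"
  shows "g \<kappa> p (J \<kappa> p v) (J \<kappa> p w) = g \<kappa> p v w"
proof -
  have pos: "f (radius rp p) > 0"
    using f[OF radius_b, of p] factor_pos(1)[of p] polar_chart_at(2)[OF \<kappa>] by simp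
  note Jp = J_polar[OF J \<kappa>]
  have gp: "g \<kappa> p v w = 1 / f (radius rp p) * (dr v * dr w) + f (radius rp p) * (dphi v * dphi w)
                       + (radius rp p) ^ 2 * (\<Sum>i\<in>UNIV. dtheta i v * dtheta i w)" for v w
    using g \<kappa> unfolding is_metric_g_def Let_def by blast
  have split: "(\<Sum>i\<in>UNIV. F i) = (\<Sum>j\<in>UNIV. F (Inl j)) + (\<Sum>j\<in>UNIV. F (Inr j))"
    for F :: "'k + 'k \<Rightarrow> real"
    by (simp add: UNIV_Plus_UNIV[symmetric] sum.Plus del: UNIV_Plus_UNIV)
  show ?thesis unfolding gp split Jp using pos by (simp add: field_simps)
qed

text \<open>
  The content is \<open>dW = (2 \<pi> / \<beta>) W (dr / f - \<i> d\<phi>)\<close>; the number \<open>e\<close> is \<open>(2 \<pi> / \<beta>) W\<close>.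
\<close>

lemma dtransition_polar_holo:
  assumes \<kappa>: "\<kappa> \<in> polar_charts rp \<beta> L" and \<zeta>: "\<zeta> \<in> holo_charts" and q: "q \<in> cdom \<kappa>" "q \<in> cdom \<zeta>"
  obtains e where "\<And>v. fst (dtransition \<kappa> \<zeta> q v) = (dr v / f (radius rp q)) *\<^sub>R e - dphi v *\<^sub>R (\<i> * e)"
    "\<And>v i. decomplexify (snd (dtransition \<kappa> \<zeta> q v)) $ i = dtheta i v"
proof -
  let ?S = "cmap \<kappa> ` (cdom \<kappa> \<inter> cdom \<zeta>)"
  let ?T = "transition \<kappa> \<zeta>"
  have \<kappa>A: "\<kappa> \<in> A" using \<kappa> by (simp add: the_atlas_def)
  have S: "open ?S" by (rule open_overlap[OF atlas_chart[OF \<kappa>A] holo_chart[OF \<zeta>]])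
  define x where "x = cmap \<kappa> q"
  have x: "x \<in> ?S" using q by (auto simp: x_def)
  have T': "(?T has_derivative dtransition \<kappa> \<zeta> q) (at x)"
    unfolding dtransition_def x_def
    by (rule smooth_on_has_derivative[OF holo_transition_smooth[OF \<kappa>A \<zeta>]]) (use q in auto)
  define r where "r = radius rp q"
  have r: "fst x = r" "rp < r" "b < r"
    using polar_chart_at[OF \<kappa> q(1)] b by (auto simp: r_def x_def)
  have fr: "f r = (r - rp) * Q r" using f[OF r(3)] .
  have pos: "Q r > 0" "E r > 0" using Q(2) E(2) r by auto
  define m where "m = sqrt ((r - rp) * E r)"
  define e0 where "e0 = cis (- (2 * pi / \<beta>) * fst (snd x))"
  define e where "e = (2 * pi / \<beta> * m) *\<^sub>R e0"
  have m: "m > 0" "m * m = (r - rp) * E r" using pos r by (auto simp: m_def)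
  have dK: "((\<lambda>r. sqrt ((r - rp) * E r)) has_real_derivative
      inverse (sqrt ((r - rp) * E r)) / 2 * ((4 * pi / \<beta>) * (E r / Q r))) (at r)"
    by (rule DERIV_chain2[OF DERIV_real_sqrt K'[OF r(3)]]) (use pos r in auto)
  \<comment> \<open>logarithmic derivative of \<open>sqrt K\<close>: half of \<open>K' / K = (4 \<pi> / \<beta>) / f\<close>\<close>
  have coef: "inverse m / 2 * ((4 * pi / \<beta>) * (E r / Q r)) = 2 * pi / \<beta> * m / f r"
  proof -
    have "2 * pi / \<beta> * m / f r = 2 * pi / \<beta> * (m * m) / (m * f r)" using m(1) by simp
    also have "\<dots> = inverse m / 2 * ((4 * pi / \<beta>) * (E r / Q r))"
      unfolding m(2) fr using r pos m(1) \<beta> by (simp add: field_simps)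
    finally show ?thesis by simp
  qed
  have dK': "((\<lambda>r. sqrt ((r - rp) * E r)) has_derivative (*) (2 * pi / \<beta> * m / f r)) (at (fst x))"
    using dK unfolding has_field_derivative_def m_def[symmetric] coef r(1) .
  have d1: "((\<lambda>y. sqrt ((fst y - rp) * E (fst y))) has_derivative
       (\<lambda>v. (2 * pi / \<beta> * m / f r) * fst v)) (at x)"
    by (rule has_derivative_compose[OF has_derivative_fst[OF has_derivative_ident] dK'])
  have d2: "((\<lambda>y. cis (- (2 * pi / \<beta>) * fst (snd y))) has_derivative
       (\<lambda>v. (- (2 * pi / \<beta>) * fst (snd v)) *\<^sub>R (\<i> * e0))) (at x)"
    unfolding e0_def
    by (intro has_derivative_cis has_derivative_mult_right has_derivative_fst has_derivative_snd has_derivative_ident)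
  have d3: "((\<lambda>y. sqrt ((fst y - rp) * E (fst y)) *\<^sub>R cis (- (2 * pi / \<beta>) * fst (snd y))) has_derivative
     (\<lambda>v. m *\<^sub>R ((- (2 * pi / \<beta>) * fst (snd v)) *\<^sub>R (\<i> * e0)) + (2 * pi / \<beta> * m / f r * fst v) *\<^sub>R e0)) (at x)"
    using has_derivative_scaleR[OF d1 d2] by (simp only: r(1) m_def[symmetric] e0_def[symmetric])
  have Tfst: "sqrt ((fst y - rp) * E (fst y)) *\<^sub>R cis (- (2 * pi / \<beta>) * fst (snd y)) = fst (?T y)"
    if "y \<in> ?S" for y
  proof -
    from that obtain q' where q': "q' \<in> cdom \<kappa>" "q' \<in> cdom \<zeta>" "y = cmap \<kappa> q'" by auto
    have T: "?T y = cmap \<zeta> q'"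
      using is_chart_inv[OF atlas_chart[OF \<kappa>A] q'(1)] q'(3) by (simp add: transition_def)
    show ?thesis
      unfolding T holo_chart_at(1)[OF \<zeta> q'(2)] polar_chart_at(3)[OF \<kappa> q'(1)]
      using polar_chart_at(1)[OF \<kappa> q'(1)] q'(3)
      by (simp add: real_sqrt_mult cis_cnj mult.commute)
  qed
  have "((\<lambda>y. fst (?T y)) has_derivative
     (\<lambda>v. m *\<^sub>R ((- (2 * pi / \<beta>) * fst (snd v)) *\<^sub>R (\<i> * e0)) + (2 * pi / \<beta> * m / f r * fst v) *\<^sub>R e0)) (at x)"
    by (rule has_derivative_transform_within_open[OF d3 S x Tfst])
  from has_derivative_unique[OF has_derivative_fst[OF T'] this]
  have "fst (dtransition \<kappa> \<zeta> q v) =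
     m *\<^sub>R ((- (2 * pi / \<beta>) * fst (snd v)) *\<^sub>R (\<i> * e0)) + (2 * pi / \<beta> * m / f r * fst v) *\<^sub>R e0" for v
    by (rule fun_cong)
  then have one: "fst (dtransition \<kappa> \<zeta> q v) = (dr v / f (radius rp q)) *\<^sub>R e - dphi v *\<^sub>R (\<i> * e)" for v
    by (simp add: e_def dr_def dphi_def r_def[symmetric] mult.commute mult.left_commute)
  have two: "decomplexify (snd (dtransition \<kappa> \<zeta> q v)) $ i = dtheta i v" for v i
  proof -
    have "bounded_linear (\<lambda>y :: complex \<times> (complex ^ 'k). decomplexify (snd y) $ i)"
      by (rule bounded_linear_compose[OF bounded_linear_vec_nth
            bounded_linear_compose[OF bounded_linear_decomplexify bounded_linear_snd]])
    from bounded_linear.has_derivative[OF this T']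
    have t1: "((\<lambda>y. decomplexify (snd (?T y)) $ i) has_derivative
      (\<lambda>v. decomplexify (snd (dtransition \<kappa> \<zeta> q v)) $ i)) (at x)" .
    have t2: "((\<lambda>y. snd (snd y) $ i) has_derivative (\<lambda>v. dtheta i v)) (at x)"
      unfolding dtheta_def
      by (rule bounded_linear.has_derivative[OF bounded_linear_compose[OF bounded_linear_vec_nth
            bounded_linear_compose[OF bounded_linear_snd bounded_linear_snd]] has_derivative_ident])
    have t3: "cis (2 * pi / L $ i * decomplexify (snd (?T y)) $ i) = cis (2 * pi / L $ i * snd (snd y) $ i)"
      if "y \<in> ?S" for y
    proof -
      from that obtain q' where q': "q' \<in> cdom \<kappa>" "q' \<in> cdom \<zeta>" "y = cmap \<kappa> q'" by auto
      have T: "?T y = cmap \<zeta> q'"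
        using is_chart_inv[OF atlas_chart[OF \<kappa>A] q'(1)] q'(3) by (simp add: transition_def)
      show ?thesis
        unfolding T using holo_chart_at(2)[OF \<zeta> q'(2)] polar_chart_at(4)[OF \<kappa> q'(1)] q'(3)
        by (simp add: is_torus_coord_def)
    qed
    have "2 * pi / L $ i \<noteq> 0" using L[of i] by simp
    from derivative_eq_of_cis_eq[OF t1 t2 S x t3 this] show ?thesis by (rule fun_cong)
  qed
  show ?thesis using one two by (rule that)
qed

lemma J_holo_polar:
  assumes J: "almost_complex_structure A J" "is_structure_J f rp \<beta> L J"
    and \<kappa>: "\<kappa> \<in> polar_charts rp \<beta> L" and \<zeta>: "\<zeta> \<in> holo_charts" and q: "q \<in> cdom \<kappa>" "q \<in> cdom \<zeta>"
  shows "dtransition \<kappa> \<zeta> q (J \<kappa> q v) = times_i (dtransition \<kappa> \<zeta> q v)"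
proof -
  obtain e where 1: "\<And>v. fst (dtransition \<kappa> \<zeta> q v) = (dr v / f (radius rp q)) *\<^sub>R e - dphi v *\<^sub>R (\<i> * e)"
    and 2: "\<And>v i. decomplexify (snd (dtransition \<kappa> \<zeta> q v)) $ i = dtheta i v"
    using dtransition_polar_holo[OF \<kappa> \<zeta> q] by blast
  note Jp = J_polar[OF J \<kappa> q(1)]
  have pos: "f (radius rp q) > 0"
    using f[OF radius_b, of q] factor_pos(1)[of q] polar_chart_at(2)[OF \<kappa> q(1)] by simp
  have "fst (dtransition \<kappa> \<zeta> q (J \<kappa> q v)) = \<i> * fst (dtransition \<kappa> \<zeta> q v)"
    unfolding 1 Jp using pos by (simp add: scaleR_conv_of_real field_simps)
  moreover have "snd (dtransition \<kappa> \<zeta> q (J \<kappa> q v)) = \<i> *s snd (dtransition \<kappa> \<zeta> q v)"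
  proof -
    have re: "Re (snd (dtransition \<kappa> \<zeta> q u) $ j) = dtheta (Inl j) u"
      and im: "Im (snd (dtransition \<kappa> \<zeta> q u) $ j) = - dtheta (Inr j) u" for u j
      using 2[of u "Inl j"] 2[of u "Inr j"] by (auto simp: decomplexify_def)
    show ?thesis by (simp add: vec_eq_iff complex_eq_iff re im Jp)
  qed
  ultimately show ?thesis by (simp add: times_i_def prod_eq_iff)
qed

section \<open>The identities in all charts\<close>

lemma J_law:
  assumes "almost_complex_structure A J" "\<kappa> \<in> A" "\<kappa>' \<in> A" "q \<in> cdom \<kappa>" "q \<in> cdom \<kappa>'"
  shows "J \<kappa>' q (dtransition \<kappa> \<kappa>' q v) = dtransition \<kappa> \<kappa>' q (J \<kappa> q v)"
  using assms unfolding almost_complex_structure_def smooth_endo_field_def by blast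

text \<open>
  Around a point with \<open>r > rp\<close> there is a polar chart, and the chain rule passes through it.
\<close>

lemma J_holo_off_bolt:
  assumes J: "almost_complex_structure A J" "is_structure_J f rp \<beta> L J"
    and \<kappa>: "\<kappa> \<in> A" and \<zeta>: "\<zeta> \<in> holo_charts" and q: "q \<in> cdom \<kappa>" "q \<in> cdom \<zeta>" "rp < radius rp q"
  shows "dtransition \<kappa> \<zeta> q (J \<kappa> q v) = times_i (dtransition \<kappa> \<zeta> q v)"
proof -
  have "q \<in> plane_times_torus" using is_chart_subset[OF atlas_chart[OF \<kappa>]] q(1) by blast
  then obtain \<kappa>' where \<kappa>': "\<kappa>' \<in> polar_charts rp \<beta> L" "q \<in> cdom \<kappa>'"
    using polar_chart_exists q(3) by blast
  have \<kappa>'A: "\<kappa>' \<in> A" using \<kappa>'(1) by (simp add: the_atlas_def)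
  have ch: "dtransition \<kappa> \<zeta> q u = dtransition \<kappa>' \<zeta> q (dtransition \<kappa> \<kappa>' q u)" for u
    by (rule dtransition_chain[OF atlas_chart[OF \<kappa>] atlas_chart[OF \<kappa>'A] holo_chart[OF \<zeta>]
        atlas_transition_smooth[OF \<kappa> \<kappa>'A] holo_transition_smooth[OF \<kappa>'A \<zeta>] q(1) \<kappa>'(2) q(2)])
  show ?thesis
    unfolding ch J_law[OF J(1) \<kappa> \<kappa>'A q(1) \<kappa>'(2), symmetric]
    by (rule J_holo_polar[OF J \<kappa>'(1) \<zeta> \<kappa>'(2) q(2)])
qed

lemma metric_compatible_off_bolt:
  assumes J: "almost_complex_structure A J" "is_structure_J f rp \<beta> L J"
    and g: "smooth_bilinear_field A g" "is_metric_g f rp \<beta> L g"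
    and \<kappa>: "\<kappa> \<in> A" and q: "q \<in> cdom \<kappa>" "rp < radius rp q"
  shows "g \<kappa> q (J \<kappa> q v) (J \<kappa> q w) = g \<kappa> q v w"
proof -
  have "q \<in> plane_times_torus" using is_chart_subset[OF atlas_chart[OF \<kappa>]] q(1) by blast
  then obtain \<kappa>' where \<kappa>': "\<kappa>' \<in> polar_charts rp \<beta> L" "q \<in> cdom \<kappa>'"
    using polar_chart_exists q(2) by blast
  have \<kappa>'A: "\<kappa>' \<in> A" using \<kappa>'(1) by (simp add: the_atlas_def)
  have law: "g \<kappa> q u u' = g \<kappa>' q (dtransition \<kappa> \<kappa>' q u) (dtransition \<kappa> \<kappa>' q u')" for u u'
    using g(1) \<kappa> \<kappa>'A q(1) \<kappa>'(2) unfolding smooth_bilinear_field_def by (metis IntI)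
  show ?thesis
    unfolding law J_law[OF J(1) \<kappa> \<kappa>'A q(1) \<kappa>'(2), symmetric]
    by (rule metric_compatible_polar[OF J g(2) \<kappa>'])
qed

lemma core_off_axis:
  assumes "\<kappa> \<in> core_charts f rp L" "x \<in> cmap \<kappa> ` cdom \<kappa>" "fst x \<noteq> 0"
  shows "rp < radius rp (cinv \<kappa> x)"
proof -
  have "disc_coord (cinv \<kappa> x) \<noteq> 0"
    using core_chart_at(2)[OF assms(1) cinv_in_dom[OF assms(2)]] assms(3)
    unfolding cmap_cinv[OF assms(2)] by (auto simp: complex_eq_iff)
  then show ?thesis by (auto simp: disc_coord_def radius_def)
qed

lemma J_continuous:
  assumes "almost_complex_structure A J" "\<kappa> \<in> A"
  shows "continuous_on (cmap \<kappa> ` cdom \<kappa>) (\<lambda>x. J \<kappa> (cinv \<kappa> x) v)"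
  by (rule smooth_on_imp_continuous_on)
    (use assms in \<open>unfold almost_complex_structure_def smooth_endo_field_def, blast\<close>)

lemma continuous_on_times_i:
  fixes F :: "'a::topological_space \<Rightarrow> complex \<times> (complex ^ 'i::finite)"
  assumes "continuous_on S F" shows "continuous_on S (\<lambda>x. times_i (F x))"
  unfolding times_i_def vector_scalar_mult_def
  by (intro continuous_intros assms)

lemma J_holo_core:
  assumes J: "almost_complex_structure A J" "is_structure_J f rp \<beta> L J"
    and \<kappa>: "\<kappa> \<in> core_charts f rp L" and \<zeta>: "\<zeta> \<in> holo_charts" and q: "q \<in> cdom \<kappa>" "q \<in> cdom \<zeta>"
  shows "dtransition \<kappa> \<zeta> q (J \<kappa> q v) = times_i (dtransition \<kappa> \<zeta> q v)"
proof -
  have \<kappa>A: "\<kappa> \<in> A" using \<kappa> by (simp add: the_atlas_def)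
  let ?S = "cmap \<kappa> ` (cdom \<kappa> \<inter> cdom \<zeta>)"
  have S: "open ?S" by (rule open_overlap[OF atlas_chart[OF \<kappa>A] holo_chart[OF \<zeta>]])
  have sub: "?S \<subseteq> cmap \<kappa> ` cdom \<kappa>" by blast
  let ?D = "\<lambda>x. frechet_derivative (transition \<kappa> \<zeta>) (at x)"
  have D: "dtransition \<kappa> \<zeta> (cinv \<kappa> x) = ?D x" if "x \<in> ?S" for x
    unfolding dtransition_def cmap_cinv[OF subsetD[OF sub that]] ..
  note sm = holo_transition_smooth[OF \<kappa>A \<zeta>]
  have cD: "continuous_on ?S (\<lambda>x. ?D x u)" for u
    by (rule smooth_on_imp_continuous_on[OF smooth_on_frechet_derivative[OF sm]])
  have lin: "linear (?D x)" if "x \<in> ?S" for x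
    using smooth_on_has_derivative[OF sm that] has_derivative_linear by blast
  let ?F = "\<lambda>x. ?D x (J \<kappa> (cinv \<kappa> x) v) - times_i (?D x v)"
  have "continuous_on ?S (\<lambda>x. ?D x (J \<kappa> (cinv \<kappa> x) v))"
    by (rule continuous_on_linear_apply[where B = ?D, OF lin cD
          continuous_on_subset[OF J_continuous[OF J(1) \<kappa>A] sub]])
  then have cF: "continuous_on ?S ?F"
    by (rule continuous_on_diff[OF _ continuous_on_times_i[OF cD]])
  have "?F x = 0" if x: "x \<in> ?S" "fst x \<noteq> 0" for x
  proof -
    have "cinv \<kappa> x \<in> cdom \<kappa>" "cinv \<kappa> x \<in> cdom \<zeta>"
      using x(1) is_chart_inv[OF atlas_chart[OF \<kappa>A]] by auto
    from J_holo_off_bolt[OF J \<kappa>A \<zeta> this core_off_axis[OF \<kappa> _ x(2)], of v]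
    show ?thesis using x(1) sub D[OF x(1)] by auto
  qed
  from continuous_eq_zero_off_hyperplane[OF S cF this, of "cmap \<kappa> q"]
  have "?F (cmap \<kappa> q) = 0" using q by blast
  then show ?thesis
    using is_chart_inv[OF atlas_chart[OF \<kappa>A] q(1)] by (simp add: dtransition_def)
qed

lemma metric_compatible_core:
  assumes J: "almost_complex_structure A J" "is_structure_J f rp \<beta> L J"
    and g: "smooth_bilinear_field A g" "is_metric_g f rp \<beta> L g"
    and \<kappa>: "\<kappa> \<in> core_charts f rp L" and q: "q \<in> cdom \<kappa>"
  shows "g \<kappa> q (J \<kappa> q v) (J \<kappa> q w) = g \<kappa> q v w"
proof -
  have \<kappa>A: "\<kappa> \<in> A" using \<kappa> by (simp add: the_atlas_def)
  let ?S = "cmap \<kappa> ` cdom \<kappa>"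
  have S: "open ?S" by (rule is_chart_open_image[OF atlas_chart[OF \<kappa>A]])
  have bil: "bilinear (g \<kappa> (cinv \<kappa> x))" if "x \<in> ?S" for x
    using g(1) \<kappa>A cinv_in_dom[OF that] by (auto simp: smooth_bilinear_field_def)
  have cg: "continuous_on ?S (\<lambda>x. g \<kappa> (cinv \<kappa> x) u u')" for u u'
    by (rule smooth_on_imp_continuous_on)
      (use g(1) \<kappa>A in \<open>unfold smooth_bilinear_field_def, blast\<close>)
  note cJ = J_continuous[OF J(1) \<kappa>A]
  let ?F = "\<lambda>x. g \<kappa> (cinv \<kappa> x) (J \<kappa> (cinv \<kappa> x) v) (J \<kappa> (cinv \<kappa> x) w) - g \<kappa> (cinv \<kappa> x) v w"
  have "continuous_on ?S (\<lambda>x. g \<kappa> (cinv \<kappa> x) (J \<kappa> (cinv \<kappa> x) v) (J \<kappa> (cinv \<kappa> x) w))"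
  proof (rule continuous_on_linear_apply[where B = "\<lambda>x. g \<kappa> (cinv \<kappa> x) (J \<kappa> (cinv \<kappa> x) v)", OF _ _ cJ])
    show "linear (g \<kappa> (cinv \<kappa> x) (J \<kappa> (cinv \<kappa> x) v))" if "x \<in> ?S" for x
      using bil[OF that] unfolding bilinear_def by blast
    have "linear (\<lambda>u. g \<kappa> (cinv \<kappa> x) u c)" if "x \<in> ?S" for x c
      using bil[OF that] unfolding bilinear_def by blast
    then show "continuous_on ?S (\<lambda>x. g \<kappa> (cinv \<kappa> x) (J \<kappa> (cinv \<kappa> x) v) c)" for c
      by (rule continuous_on_linear_apply[where B = "\<lambda>x u. g \<kappa> (cinv \<kappa> x) u c", OF _ cg cJ])
  qed
  then have cF: "continuous_on ?S ?F" by (intro continuous_on_diff cg)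
  have "?F x = 0" if x: "x \<in> ?S" "fst x \<noteq> 0" for x
    using metric_compatible_off_bolt[OF J g \<kappa>A cinv_in_dom[OF x(1)] core_off_axis[OF \<kappa> x], of v w]
    by simp
  from continuous_eq_zero_off_hyperplane[OF S cF this, of "cmap \<kappa> q"]
  have "?F (cmap \<kappa> q) = 0" using q by blast
  then show ?thesis
    using is_chart_inv[OF atlas_chart[OF \<kappa>A] q] by simp
qed

lemma integrable:
  assumes J: "almost_complex_structure A J" "is_structure_J f rp \<beta> L J"
  shows "integrable_structure plane_times_torus A J"
  unfolding integrable_structure_def
proof
  fix p :: "'k point" assume "p \<in> plane_times_torus"
  then obtain \<zeta> where \<zeta>: "\<zeta> \<in> holo_charts" "p \<in> cdom \<zeta>" using holo_chart_exists by blast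
  have "dtransition \<kappa> \<zeta> q (J \<kappa> q v) = times_i (dtransition \<kappa> \<zeta> q v)"
    if "\<kappa> \<in> A" "q \<in> cdom \<kappa> \<inter> cdom \<zeta>" for \<kappa> q v
    using that J_holo_polar[OF J _ \<zeta>(1)] J_holo_core[OF J _ \<zeta>(1)] unfolding the_atlas_def by blast
  with \<zeta> holo_chart holo_smoothly_compatible show "\<exists>\<zeta> :: ('k point, complex \<times> (complex ^ 'k)) chart.
        p \<in> cdom \<zeta> \<and> is_chart plane_times_torus \<zeta> \<and> (\<forall>\<kappa>\<in>A. smoothly_compatible \<kappa> \<zeta>) \<and>
        (\<forall>\<kappa>\<in>A. \<forall>q\<in>cdom \<kappa> \<inter> cdom \<zeta>. \<forall>v.
           dtransition \<kappa> \<zeta> q (J \<kappa> q v) = times_i (dtransition \<kappa> \<zeta> q v))"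
    by blast
qed

lemma compatible:
  assumes J: "almost_complex_structure A J" "is_structure_J f rp \<beta> L J"
    and g: "riemannian_metric A g" "is_metric_g f rp \<beta> L g"
  shows "metric_compatible A g J"
proof -
  have "smooth_bilinear_field A g" using g(1) by (simp add: riemannian_metric_def)
  then show ?thesis
    using metric_compatible_polar[OF J g(2)] metric_compatible_core[OF J _ g(2)]
    unfolding metric_compatible_def the_atlas_def by blast
qed

end

section \<open>The function V\<close>

text \<open>
  The equation \<open>K' / K = c / ((r - rp) * Q r)\<close> for \<open>K r = (r - rp) * E r\<close> amounts to
  \<open>E' / E = (c / Q r - 1) / (r - rp) = - Q2 r / Q r\<close>, which is regular at \<open>rp\<close> and can be integrated from
  a point \<open>b\<close> slightly below \<open>rp\<close>.
\<close>

lemma regularising_factor: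
  fixes Q Q2 :: "real \<Rightarrow> real"
  assumes rp: "0 < rp" and Q: "smooth_on {0<..} Q" and Q2: "smooth_on {0<..} Q2"
    and eq: "\<And>r. 0 < r \<Longrightarrow> Q r = c + (r - rp) * Q2 r" and pos: "\<And>r. rp \<le> r \<Longrightarrow> 0 < Q r"
  obtains b E where "0 < b" "b < rp" "\<And>r. b < r \<Longrightarrow> 0 < Q r" "smooth_on {b<..} E" "\<And>r. 0 < E r"
    "\<And>r. b < r \<Longrightarrow> ((\<lambda>r. (r - rp) * E r) has_real_derivative c * (E r / Q r)) (at r)"
proof -
  have "open ({0<..} \<inter> Q -` {0<..})"
    by (rule continuous_open_preimage[OF smooth_on_imp_continuous_on[OF Q]]) auto
  then obtain e where e: "e > 0" "ball rp e \<subseteq> {0<..} \<inter> Q -` {0<..}"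
    using rp pos[of rp] by (metis IntI greaterThan_iff open_contains_ball order_refl vimageI)
  \<comment> \<open>strictly inside the neighbourhood where \<open>Q > 0\<close>, so that \<open>Q > 0\<close> holds at \<open>b\<close> too and the
    integrand below is continuous up to \<open>b\<close>\<close>
  define b where "b = max (rp / 2) (rp - e / 2)"
  have b: "0 < b" "b < rp" using rp e(1) by (auto simp: b_def)
  have Qpos: "0 < Q r" if "b \<le> r" for r
  proof (cases "rp \<le> r")
    case False
    then have "r \<in> ball rp e" using that e(1) by (auto simp: b_def dist_real_def)
    then show ?thesis using e(2) by auto
  qed (rule pos)
  define I where "I = (\<lambda>r. integral {b..r} (\<lambda>s. Q2 s / Q s))"
  define E where "E = (\<lambda>r. exp (- I r))"
  have cont: "continuous_on {b..t} (\<lambda>s. Q2 s / Q s)" for t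
  proof -
    have sub: "{b..t} \<subseteq> {0<..}" using b by auto
    show ?thesis
      by (intro continuous_on_divide continuous_on_subset[OF smooth_on_imp_continuous_on[OF Q] sub]
        continuous_on_subset[OF smooth_on_imp_continuous_on[OF Q2] sub] ballI)
        (use Qpos in \<open>auto simp: less_imp_neq[THEN not_sym]\<close>)
  qed
  have dI: "(I has_real_derivative Q2 r / Q r) (at r)" if "b < r" for r
  proof -
    have "(I has_real_derivative Q2 r / Q r) (at r within {b..r + 1})"
      unfolding I_def by (rule integral_has_real_derivative[OF cont]) (use that in auto)
    then show ?thesis using at_within_Icc_at[of b r "r + 1"] that by simp
  qed
  have sub: "{b<..} \<subseteq> {0<..}" using b by auto
  have "smooth_on {b<..} (\<lambda>r. Q2 r / Q r)"
    by (rule smooth_on_divide[OF _ smooth_on_subset[OF Q2 sub] smooth_on_subset[OF Q sub]])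
      (use Qpos in \<open>auto simp: less_imp_neq[THEN not_sym]\<close>)
  then have sI: "smooth_on {b<..} I"
    by (rule smooth_on_real_antiderivative[rotated 2])
      (use dI in \<open>auto simp: has_real_derivative_iff_has_vector_derivative\<close>)
  have sE: "smooth_on {b<..} E"
    unfolding E_def
    by (rule smooth_on_exp[OF _ smooth_on_bounded_linear[OF bounded_linear_minus[OF bounded_linear_ident] _ sI]]) auto
  have dK: "((\<lambda>r. (r - rp) * E r) has_real_derivative c * (E r / Q r)) (at r)" if r: "b < r" for r
  proof -
    have dE: "(E has_real_derivative - (Q2 r / Q r) * E r) (at r)"
      unfolding E_def by (auto intro!: derivative_eq_intros dI[OF r])
    have lin: "((\<lambda>r. r - rp) has_real_derivative 1) (at r)" by (auto intro!: derivative_eq_intros)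
    have "1 * E r + - (Q2 r / Q r) * E r * (r - rp) = c * (E r / Q r)"
    proof -
      have q: "Q r > 0" using Qpos r by simp
      have "1 * E r + - (Q2 r / Q r) * E r * (r - rp) = (Q r - (r - rp) * Q2 r) * (E r / Q r)"
        using q by (simp add: field_simps)
      also have "Q r - (r - rp) * Q2 r = c" using eq[of r] b r by simp
      finally show ?thesis .
    qed
    with DERIV_mult[OF lin dE] show ?thesis by simp
  qed
  show ?thesis
    by (rule that[OF b _ sE _ dK]) (use Qpos in \<open>auto simp: E_def\<close>)
qed

lemma poly_factor_root:
  fixes p :: "real poly"
  assumes "poly p c = 0"
  shows "poly p r = (r - c) * poly (synthetic_div p c) r"
proof -
  have "poly p r = poly ([:- c, 1:] * synthetic_div p c + [:poly p c:]) r"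
    by (simp only: synthetic_div_correct')
  then show ?thesis using assms by (simp add: algebra_simps)
qed

text \<open>
  For \<open>r > 0\<close>, \<open>V r\<close> is the polynomial \<open>r\<^sup>n + a r - r0\<^sup>n\<close> divided by \<open>l\<^sup>2 r\<^sup>n\<^sup>-\<^sup>2\<close>, so the factor \<open>r - rp\<close> can be
  split off by polynomial division, and once more from \<open>Q r - Q rp\<close>. The number \<open>c = Q rp\<close> is
  \<open>V' rp\<close>, computed by eliminating \<open>a\<close> with the help of \<open>V rp = 0\<close>. Positivity of \<open>Q\<close> beyond \<open>rp\<close>
  follows from \<open>c > 0\<close>, since \<open>V\<close> has no larger root.
\<close>

lemma V_factor:
  assumes n: "n \<ge> 2" and l: "l > 0" and rp: "largest_positive_root (V n l r0 a) rp"
    and c: "c = rp / l ^ 2 * (real n - 1 + r0 ^ n / rp ^ n)" "c > 0"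
  obtains Q Q2 where "smooth_on {0<..} Q" "smooth_on {0<..} Q2"
    "\<And>r. 0 < r \<Longrightarrow> V n l r0 a r = (r - rp) * Q r"
    "\<And>r. 0 < r \<Longrightarrow> Q r = c + (r - rp) * Q2 r"
    "\<And>r. rp \<le> r \<Longrightarrow> 0 < Q r"
proof -
  have rp0: "0 < rp" and Vrp: "V n l r0 a rp = 0" and last: "\<And>y. 0 < y \<Longrightarrow> V n l r0 a y = 0 \<Longrightarrow> y \<le> rp"
    using rp by (auto simp: largest_positive_root_def)
  obtain m where m: "n = m + 2" using n by (metis add.commute le_Suc_ex)
  define N :: "real poly" where "N = monom 1 n + [:- (r0 ^ n), a:]"
  have N: "poly N r = r ^ n + a * r - r0 ^ n" for r by (simp add: N_def poly_monom)
  define D where "D = (\<lambda>r. l ^ 2 * r ^ m)"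
  have D: "D r > 0" if "r > 0" for r using l that by (simp add: D_def)
  have VN: "V n l r0 a r = poly N r / D r" if r: "r > 0" for r
  proof -
    have "r ^ n = r * r * r ^ m" "r ^ (n - 1) = r * r ^ m" by (simp_all add: m)
    then show ?thesis unfolding V_def N D_def using r l by (simp add: field_simps power2_eq_square)
  qed
  have N0: "poly N rp = 0" using Vrp VN[OF rp0] D[OF rp0] by simp
  define N1 where "N1 = synthetic_div N rp"
  have N1: "poly N r = (r - rp) * poly N1 r" for r
    unfolding N1_def by (rule poly_factor_root[OF N0])
  define Q where "Q = (\<lambda>r. poly N1 r / D r)"
  have Qrp: "Q rp = c"
  proof -
    have "(poly N has_real_derivative (rp - rp) * poly (pderiv N1) rp + 1 * poly N1 rp) (at rp)"
      unfolding N1[abs_def] by (auto intro!: derivative_eq_intros)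
    moreover have "(poly N has_real_derivative real n * rp ^ (n - 1) + a) (at rp)"
      unfolding N[abs_def] by (auto intro!: derivative_eq_intros)
    ultimately have N1rp: "poly N1 rp = real n * rp ^ (n - 1) + a"
      using DERIV_unique by fastforce
    have pn: "rp ^ n = rp * rp * rp ^ m" "rp ^ (n - 1) = rp * rp ^ m" by (simp_all add: m)
    have a: "a = (r0 ^ n - rp ^ n) / rp" using N0 rp0 unfolding N by (simp add: field_simps)
    show ?thesis
      unfolding Q_def N1rp D_def c a pn using rp0 l by (simp add: field_simps power2_eq_square)
  qed
  define N2 where "N2 = synthetic_div (N1 - monom (c * l ^ 2) m) rp"
  have "poly (N1 - monom (c * l ^ 2) m) rp = 0"
  proof -
    have "poly N1 rp = c * D rp" using Qrp D[OF rp0] by (simp add: Q_def divide_eq_eq)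
    then show ?thesis by (simp add: D_def poly_monom mult.assoc)
  qed
  from poly_factor_root[OF this]
  have N2: "poly N1 r = c * D r + (r - rp) * poly N2 r" for r
    by (simp add: N2_def D_def poly_monom algebra_simps)
  define Q2 where "Q2 = (\<lambda>r. poly N2 r / D r)"
  have sD: "smooth_on {0<..} D"
  proof -
    have "smooth_on {0<..} (poly (monom (l ^ 2) m))" by (rule smooth_on_poly) simp
    then show ?thesis by (simp add: D_def poly_monom[abs_def])
  qed
  have sm: "smooth_on {0<..} (\<lambda>r. poly p r / D r)" for p
    by (rule smooth_on_divide[OF _ smooth_on_poly sD]) (use D in \<open>auto simp: less_imp_neq[THEN not_sym]\<close>)
  have sQ: "smooth_on {0<..} Q" and sQ2: "smooth_on {0<..} Q2"
    using sm by (simp_all add: Q_def Q2_def)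
  have VQ: "V n l r0 a r = (r - rp) * Q r" if "0 < r" for r
    using VN[OF that] by (simp add: Q_def N1)
  have QQ2: "Q r = c + (r - rp) * Q2 r" if "0 < r" for r
    using D[OF that] by (simp add: Q_def Q2_def N2 field_simps)
  have Qpos: "0 < Q r" if r: "rp \<le> r" for r
  proof (rule ccontr)
    assume neg: "\<not> 0 < Q r"
    have cont: "continuous_on {rp..r} Q"
      by (rule continuous_on_subset[OF smooth_on_imp_continuous_on[OF sQ]]) (use rp0 in auto)
    obtain x where x: "rp \<le> x" "x \<le> r" "Q x = 0"
      using IVT2'[of Q r 0 rp] neg r cont Qrp c(2) by auto
    then have "V n l r0 a x = 0" using VQ[of x] rp0 by simp
    then have "x = rp" using last[of x] x(1) rp0 by simp
    then show False using x(3) Qrp c(2) by simp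
  qed
  show ?thesis by (rule that[OF sQ sQ2 VQ QQ2 Qpos])
qed

theorem mainTheorem5:
  fixes n k :: nat
    and l r0 a rp \<beta> :: real
    and L :: "real ^ ('k::finite + 'k)"
    and g :: "('k point, 'k coords) bilinear_field"
    and J :: "('k point, 'k coords) endo_field"
  assumes k: "k = CARD('k)" "k \<ge> 1"
    and n: "n = 2 + 2 * k"
    and params: "l > 0" "r0 > 0"
    and rp: "largest_positive_root (V n l r0 a) rp"
    and beta: "\<beta> = 4 * pi * l ^ 2 / (rp * (real n - 1 + r0 ^ n / rp ^ n))"
    and periods: "\<And>i. L $ i > 0"
    and g_metric: "riemannian_metric (the_atlas (V n l r0 a) rp \<beta> L) g"
    and g_complete: "complete_metric plane_times_torus (the_atlas (V n l r0 a) rp \<beta> L) g"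
    and g_form: "is_metric_g (V n l r0 a) rp \<beta> L g"
    and J_acs: "almost_complex_structure (the_atlas (V n l r0 a) rp \<beta> L) J"
    and J_form: "is_structure_J (V n l r0 a) rp \<beta> L J"
  shows "integrable_structure plane_times_torus (the_atlas (V n l r0 a) rp \<beta> L) J \<and>
         metric_compatible (the_atlas (V n l r0 a) rp \<beta> L) g J"
proof -
  define c where "c = rp / l ^ 2 * (real n - 1 + r0 ^ n / rp ^ n)"
  have rp0: "0 < rp" using rp by (simp add: largest_positive_root_def)
  define t where "t = real n - 1 + r0 ^ n / rp ^ n"
  have t: "0 < t"
    unfolding t_def using n params(2) rp0 by (intro add_pos_pos divide_pos_pos) auto
  have c0: "0 < c" and \<beta>0: "0 < \<beta>"
    unfolding beta c_def t_def[symmetric] using t rp0 params(1) by simp_all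
  have \<beta>c: "4 * pi / \<beta> = c"
    unfolding beta c_def t_def[symmetric] using t rp0 params(1) by (simp add: field_simps)
  have n2: "2 \<le> n" using n by simp
  obtain Q Q2 where Q: "smooth_on {0<..} Q" "smooth_on {0<..} Q2"
    "\<And>r. 0 < r \<Longrightarrow> V n l r0 a r = (r - rp) * Q r"
    "\<And>r. 0 < r \<Longrightarrow> Q r = c + (r - rp) * Q2 r"
    "\<And>r. rp \<le> r \<Longrightarrow> 0 < Q r"
    using V_factor[OF n2 params(1) rp c_def c0] by blast
  obtain b E where E: "0 < b" "b < rp" "\<And>r. b < r \<Longrightarrow> 0 < Q r" "smooth_on {b<..} E" "\<And>r. 0 < E r"
    "\<And>r. b < r \<Longrightarrow> ((\<lambda>r. (r - rp) * E r) has_real_derivative c * (E r / Q r)) (at r)"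
    using regularising_factor[OF rp0 Q(1,2,4,5)] by blast
  interpret bolt "V n l r0 a" Q E b rp \<beta> L
  proof
    show "smooth_on {b<..} Q" by (rule smooth_on_subset[OF Q(1)]) (use E(1) in auto)
    show "((\<lambda>r. (r - rp) * E r) has_real_derivative 4 * pi / \<beta> * (E r / Q r)) (at r)"
      if "b < r" for r
      unfolding \<beta>c by (rule E(6)[OF that])
  qed (use E Q(3) \<beta>0 periods in auto)
  show ?thesis
    using integrable[OF J_acs J_form] compatible[OF J_acs J_form g_metric g_form] ..
qed

end
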